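(* Let $(M,\langle\cdot,\cdot\rangle)$ be a complete Riemannian manifold. Consider a semi-elliptic operator $L u=\operatorname{Tr}(P\circ\operatorname{hess}u)+\langle V,\operatorname{grad}u\rangle$, where $P:TM\to TM$ is a positive semi-definite symmetric tensor and $V$ is a vector field on $M$ with $\limsup_{x\to\infty}|V|(x)<+\infty$. Let $G:[0,\infty)\to[0,\infty)$ satisfy $G(0)>0$, $G'(t)\ge 0$ and $G^{-1/2}\notin L^1(+\infty)$. Suppose that there exists a non-negative function $\gamma\in C^2(M)$ such that: i) $\gamma(x)\to+\infty$ as $x\to\infty$; ii) there is $A>0$ such that $|\operatorname{grad}\gamma|\le A\sqrt{G(\gamma)}\left(\int_0^{\gamma}\frac{ds}{\sqrt{G(s)}}+1\right)$ off a compact set; iii) there is $B>0$ such that $\operatorname{Tr}(P\circ\operatorname{hess}\gamma)\le B\sqrt{G(\gamma)}\left(\int_0^{\gamma}\frac{ds}{\sqrt{G(s)}}+1\right)$ off a compact set. Set $\varphi(t)=\ln\left(\int_0^t\frac{ds}{\sqrt{G(s)}}+1\right)$. Then for every $u\in C^2(M)$ satisfying $$\lim_{x\to\infty}\frac{u(x)}{\varphi(\gamma(x))}=0$$ there exists a sequence $\{x_k\}_{k\in\mathbb N}\subset M$ such that $$(a)\ |\operatorname{grad}u|(x_k)<\frac1k\qquad\text{and}\qquad(b)\ Lu(x_k)<\frac1k .$$ If, instead of the condition $\lim_{x\to\infty}\frac{u(x)}{\varphi(\gamma(x))}=0$, $u\in C^2(M)$ is bounded above, then there is a sequence $\{x_k\}_{k\in\mathbb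 N}\subset M$ satisfying $|\operatorname{grad}u|(x_k)<\frac1k$, $Lu(x_k)<\frac1k$ and $$(c)\ \lim_{k\to+\infty}u(x_k)=\sup_M u .$$
   Context: For $u\in C^2(M)$, $\operatorname{hess}u:TM\to TM$ is the symmetric operator $\operatorname{hess}u(X)=\nabla_X\operatorname{grad}u$, with $\nabla$ the Levi-Civita connection. "$x\to\infty$" means that $x$ leaves every compact subset of $M$. $G^{-1/2}\notin L^1(+\infty)$ means $\int^{+\infty}\frac{ds}{\sqrt{G(s)}}=+\infty$. *)

theory Defs
  imports "HOL-Analysis.Analysis"
begin

section \<open>Functions of class \<open>C\<^sup>k\<close> on open sets\<close>

fun Ck_on :: "nat \<Rightarrow> 'a::euclidean_space set \<Rightarrow> ('a \<Rightarrow> 'b::real_normed_vector) \<Rightarrow> bool" where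
  "Ck_on 0 S f \<longleftrightarrow> continuous_on S f"
| "Ck_on (Suc k) S f \<longleftrightarrow>
     (\<forall>x\<in>S. f differentiable (at x)) \<and> (\<forall>v. Ck_on k S (\<lambda>x. frechet_derivative f (at x) v))"

definition smooth_on :: "'a::euclidean_space set \<Rightarrow> ('a \<Rightarrow> 'b::real_normed_vector) \<Rightarrow> bool" where
  "smooth_on S f \<longleftrightarrow> (\<forall>k. Ck_on k S f)"


section \<open>Smooth manifolds\<close>

text \<open>The manifold is the whole type \<open>'m\<close> with its topology. A chart is a pair consisting of its
  domain and its coordinate map.\<close>

type_synonym ('m, 'n) chart = "'m set \<times> ('m \<Rightarrow> real ^ 'n)"

definition chart_inv :: "('m, 'n) chart \<Rightarrow> real ^ 'n \<Rightarrow> 'm" where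
  "chart_inv c = inv_into (fst c) (snd c)"

definition is_chart :: "('m::topological_space, 'n::finite) chart \<Rightarrow> bool" where
  "is_chart c \<longleftrightarrow> open (fst c) \<and> open (snd c ` fst c) \<and>
     homeomorphism (fst c) (snd c ` fst c) (snd c) (chart_inv c)"

definition transition :: "('m, 'n::finite) chart \<Rightarrow> ('m, 'n) chart \<Rightarrow> real ^ 'n \<Rightarrow> real ^ 'n" where
  "transition c d = snd d \<circ> chart_inv c"

definition smooth_atlas ::
    "('m::{t2_space, second_countable_topology}, 'n::finite) chart set \<Rightarrow> bool" where
  "smooth_atlas A \<longleftrightarrow> (\<forall>c\<in>A. is_chart c) \<and> (\<Union>c\<in>A. fst c) = UNIV \<and>
     (\<forall>c\<in>A. \<forall>d\<in>A. smooth_on (snd c ` (fst c \<inter> fst d)) (transition c d))"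

definition Ck_function :: "nat \<Rightarrow> ('m, 'n::finite) chart set \<Rightarrow> ('m \<Rightarrow> real) \<Rightarrow> bool" where
  "Ck_function k A u \<longleftrightarrow> (\<forall>c\<in>A. Ck_on k (snd c ` fst c) (u \<circ> chart_inv c))"

text \<open>Tensor fields are given by their components in the charts of the atlas, subject to the
  transformation law under the differential of the transition maps; \<open>T c x\<close> is only
  meaningful for \<open>x\<close> in the domain of \<open>c\<close>. No regularity is imposed on vector fields and
  endomorphism fields.\<close>

definition coord_change :: "('m, 'n::finite) chart \<Rightarrow> ('m, 'n) chart \<Rightarrow> 'm \<Rightarrow> real ^ 'n \<Rightarrow> real ^ 'n" where
  "coord_change c d x = frechet_derivative (transition c d) (at (snd c x))"

definition vector_field ::
    "('m, 'n::finite) chart set \<Rightarrow> (('m, 'n) chart \<Rightarrow> 'm \<Rightarrow> real ^ 'n) \<Rightarrow> bool" where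
  "vector_field A V \<longleftrightarrow>
     (\<forall>c\<in>A. \<forall>d\<in>A. \<forall>x\<in>fst c \<inter> fst d. V d x = coord_change c d x (V c x))"

definition endomorphism_field ::
    "('m, 'n::finite) chart set \<Rightarrow> (('m, 'n) chart \<Rightarrow> 'm \<Rightarrow> real ^ 'n \<Rightarrow> real ^ 'n) \<Rightarrow> bool" where
  "endomorphism_field A P \<longleftrightarrow>
     (\<forall>c\<in>A. \<forall>x\<in>fst c. linear (P c x)) \<and>
     (\<forall>c\<in>A. \<forall>d\<in>A. \<forall>x\<in>fst c \<inter> fst d. \<forall>v.
        P d x (coord_change c d x v) = coord_change c d x (P c x v))"


section \<open>Riemannian metrics\<close>

type_synonym ('m, 'n) metric = "('m, 'n) chart \<Rightarrow> 'm \<Rightarrow> real ^ 'n \<Rightarrow> real ^ 'n \<Rightarrow> real"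

definition riemannian_metric :: "('m, 'n::finite) chart set \<Rightarrow> ('m, 'n) metric \<Rightarrow> bool" where
  "riemannian_metric A g \<longleftrightarrow>
     (\<forall>c\<in>A. \<forall>x\<in>fst c. bilinear (g c x) \<and> (\<forall>v w. g c x v w = g c x w v) \<and>
        (\<forall>v. v \<noteq> 0 \<longrightarrow> g c x v v > 0)) \<and>
     (\<forall>c\<in>A. \<forall>v w. smooth_on (snd c ` fst c) (\<lambda>y. g c (chart_inv c y) v w)) \<and>
     (\<forall>c\<in>A. \<forall>d\<in>A. \<forall>x\<in>fst c \<inter> fst d. \<forall>v w.
        g d x (coord_change c d x v) (coord_change c d x w) = g c x v w)"

definition riemannian_manifold ::
    "('m::{t2_space, second_countable_topology}, 'n::finite) chart set \<Rightarrow> ('m, 'n) metric \<Rightarrow> bool" where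
  "riemannian_manifold A g \<longleftrightarrow> smooth_atlas A \<and> riemannian_metric A g"

definition symmetric_field ::
    "('m, 'n::finite) chart set \<Rightarrow> ('m, 'n) metric \<Rightarrow>
     (('m, 'n) chart \<Rightarrow> 'm \<Rightarrow> real ^ 'n \<Rightarrow> real ^ 'n) \<Rightarrow> bool" where
  "symmetric_field A g P \<longleftrightarrow>
     (\<forall>c\<in>A. \<forall>x\<in>fst c. \<forall>v w. g c x (P c x v) w = g c x v (P c x w))"

definition pos_semidef_field ::
    "('m, 'n::finite) chart set \<Rightarrow> ('m, 'n) metric \<Rightarrow>
     (('m, 'n) chart \<Rightarrow> 'm \<Rightarrow> real ^ 'n \<Rightarrow> real ^ 'n) \<Rightarrow> bool" where
  "pos_semidef_field A g P \<longleftrightarrow> (\<forall>c\<in>A. \<forall>x\<in>fst c. \<forall>v. g c x (P c x v) v \<ge> 0)"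

text \<open>Scalars built from tensors are evaluated at \<open>x\<close> in an arbitrary chart around \<open>x\<close>; by the
  transformation laws the value does not depend on the chart.\<close>

definition chart_at :: "('m, 'n::finite) chart set \<Rightarrow> 'm \<Rightarrow> ('m, 'n) chart" where
  "chart_at A x = (SOME c. c \<in> A \<and> x \<in> fst c)"

definition vnorm :: "('m, 'n::finite) chart set \<Rightarrow> ('m, 'n) metric \<Rightarrow>
    (('m, 'n) chart \<Rightarrow> 'm \<Rightarrow> real ^ 'n) \<Rightarrow> 'm \<Rightarrow> real" where
  "vnorm A g V x = (let c = chart_at A x in sqrt (g c x (V c x) (V c x)))"


section \<open>Completeness\<close>

definition piecewise_C1_curve ::
    "('m::topological_space, 'n::finite) chart set \<Rightarrow> (real \<Rightarrow> 'm) \<Rightarrow> bool" where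
  "piecewise_C1_curve A \<sigma> \<longleftrightarrow> path \<sigma> \<and>
     (\<exists>S. finite S \<and> (\<forall>c\<in>A. (snd c \<circ> \<sigma>) C1_differentiable_on (({0..1} - S) \<inter> \<sigma> -` fst c)))"

definition speed :: "('m, 'n::finite) chart set \<Rightarrow> ('m, 'n) metric \<Rightarrow> (real \<Rightarrow> 'm) \<Rightarrow> real \<Rightarrow> real" where
  "speed A g \<sigma> t =
     (let c = chart_at A (\<sigma> t); v = vector_derivative (snd c \<circ> \<sigma>) (at t)
      in sqrt (g c (\<sigma> t) v v))"

definition curve_length ::
    "('m, 'n::finite) chart set \<Rightarrow> ('m, 'n) metric \<Rightarrow> (real \<Rightarrow> 'm) \<Rightarrow> ennreal" where
  "curve_length A g \<sigma> = (\<integral>\<^sup>+t\<in>{0..1}. ennreal (speed A g \<sigma> t) \<partial>lborel)"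

text \<open>The distance is infinite between different connected components.\<close>

definition rdist ::
    "('m::topological_space, 'n::finite) chart set \<Rightarrow> ('m, 'n) metric \<Rightarrow> 'm \<Rightarrow> 'm \<Rightarrow> ennreal" where
  "rdist A g x y =
     (INF \<sigma>\<in>{\<sigma>. piecewise_C1_curve A \<sigma> \<and> pathstart \<sigma> = x \<and> pathfinish \<sigma> = y}. curve_length A g \<sigma>)"

definition complete_riemannian ::
    "('m::topological_space, 'n::finite) chart set \<Rightarrow> ('m, 'n) metric \<Rightarrow> bool" where
  "complete_riemannian A g \<longleftrightarrow>
     (\<forall>X :: nat \<Rightarrow> 'm.
        (\<forall>e>0. \<exists>N. \<forall>i\<ge>N. \<forall>j\<ge>N. rdist A g (X i) (X j) < ennreal e) \<longrightarrow>
        (\<exists>x. (\<lambda>i. rdist A g (X i) x) \<longlonglongrightarrow> 0))"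


section \<open>Gradient, Levi-Civita connection and Hessian\<close>

definition grad :: "('m, 'n::finite) metric \<Rightarrow> ('m \<Rightarrow> real) \<Rightarrow> ('m, 'n) chart \<Rightarrow> 'm \<Rightarrow> real ^ 'n" where
  "grad g u c x =
     (THE w. \<forall>v. g c x w v = frechet_derivative (u \<circ> chart_inv c) (at (snd c x)) v)"

text \<open>\<open>\<Gamma> v w\<close> is the covariant derivative in direction \<open>v\<close> of the field whose components in the
  chart are constantly \<open>w\<close>. The conditions say that the connection is torsion-free and
  compatible with the metric at \<open>x\<close>; they determine \<open>\<Gamma>\<close>, see below.\<close>

definition levi_civita_at ::
    "('m, 'n::finite) metric \<Rightarrow> ('m, 'n) chart \<Rightarrow> 'm \<Rightarrow>
     (real ^ 'n \<Rightarrow> real ^ 'n \<Rightarrow> real ^ 'n) \<Rightarrow> bool" where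
  "levi_civita_at g c x \<Gamma> \<longleftrightarrow> bilinear \<Gamma> \<and> (\<forall>v w. \<Gamma> v w = \<Gamma> w v) \<and>
     (\<forall>z v w. frechet_derivative (\<lambda>y. g c (chart_inv c y) v w) (at (snd c x)) z =
        g c x (\<Gamma> z v) w + g c x v (\<Gamma> z w))"

definition christoffel ::
    "('m, 'n::finite) metric \<Rightarrow> ('m, 'n) chart \<Rightarrow> 'm \<Rightarrow> real ^ 'n \<Rightarrow> real ^ 'n \<Rightarrow> real ^ 'n" where
  "christoffel g c x = (THE \<Gamma>. levi_civita_at g c x \<Gamma>)"

definition cov_deriv ::
    "('m, 'n::finite) metric \<Rightarrow> (('m, 'n) chart \<Rightarrow> 'm \<Rightarrow> real ^ 'n) \<Rightarrow>
     ('m, 'n) chart \<Rightarrow> 'm \<Rightarrow> real ^ 'n \<Rightarrow> real ^ 'n" where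
  "cov_deriv g Y c x v =
     frechet_derivative (Y c \<circ> chart_inv c) (at (snd c x)) v + christoffel g c x v (Y c x)"

definition hess :: "('m, 'n::finite) metric \<Rightarrow> ('m \<Rightarrow> real) \<Rightarrow>
     ('m, 'n) chart \<Rightarrow> 'm \<Rightarrow> real ^ 'n \<Rightarrow> real ^ 'n" where
  "hess g u = cov_deriv g (grad g u)"

definition trace_hess ::
    "('m, 'n::finite) chart set \<Rightarrow> ('m, 'n) metric \<Rightarrow>
     (('m, 'n) chart \<Rightarrow> 'm \<Rightarrow> real ^ 'n \<Rightarrow> real ^ 'n) \<Rightarrow> ('m \<Rightarrow> real) \<Rightarrow> 'm \<Rightarrow> real" where
  "trace_hess A g P u x = (let c = chart_at A x in trace (matrix (P c x \<circ> hess g u c x)))"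

definition semi_elliptic_op ::
    "('m, 'n::finite) chart set \<Rightarrow> ('m, 'n) metric \<Rightarrow>
     (('m, 'n) chart \<Rightarrow> 'm \<Rightarrow> real ^ 'n \<Rightarrow> real ^ 'n) \<Rightarrow> (('m, 'n) chart \<Rightarrow> 'm \<Rightarrow> real ^ 'n) \<Rightarrow>
     ('m \<Rightarrow> real) \<Rightarrow> 'm \<Rightarrow> real" where
  "semi_elliptic_op A g P V u x =
     trace_hess A g P u x + (let c = chart_at A x in g c x (V c x) (grad g u c x))"


section \<open>Behaviour at infinity\<close>

definition leaving_compacts :: "'m::topological_space filter" where
  "leaving_compacts = (INF K\<in>{K. compact K}. principal (- K))"

definition phi :: "(real \<Rightarrow> real) \<Rightarrow> real \<Rightarrow> real" where
  "phi G t = ln (integral {0..t} (\<lambda>s. 1 / sqrt (G s)) + 1)"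


section \<open>Well-definedness\<close>

lemma eventually_leaving_compacts:
  "eventually Q leaving_compacts \<longleftrightarrow>
     (\<exists>K::'m::topological_space set. compact K \<and> (\<forall>x. x \<notin> K \<longrightarrow> Q x))"
proof -
  have "eventually Q leaving_compacts \<longleftrightarrow>
      (\<exists>K\<in>{K::'m set. compact K}. eventually Q (principal (- K)))"
    unfolding leaving_compacts_def
  proof (rule eventually_INF_base)
    show "{K::'m set. compact K} \<noteq> {}" using compact_empty by blast
    fix K L :: "'m set" assume "K \<in> {K. compact K}" "L \<in> {K. compact K}"
    then show "\<exists>J\<in>{K. compact K}. principal (- J) \<le> inf (principal (- K)) (principal (- L))"
      by (intro bexI[of _ "K \<union> L"]) (auto intro: compact_Un)
  qed
  then show ?thesis by (auto simp: eventually_principal)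
qed

lemma metric_riesz:
  fixes h :: "real ^ 'n::finite \<Rightarrow> real ^ 'n \<Rightarrow> real"
  assumes h: "bilinear h" and pos: "\<And>v. v \<noteq> 0 \<Longrightarrow> h v v > 0" and l: "linear l"
  shows "\<exists>!w. \<forall>v. h w v = l v"
proof -
  have lin1: "linear (\<lambda>w. h w v)" and lin2: "linear (h w)" for v w
    using h by (auto simp: bilinear_def)
  define T where "T w = (\<Sum>b\<in>Basis. h w b *\<^sub>R b)" for w
  have TB: "T w \<bullet> b = h w b" if "b \<in> Basis" for w b
    using that unfolding T_def by simp
  have hT: "h w v = T w \<bullet> v" for w v
  proof -
    have "h w v = h w (\<Sum>b\<in>Basis. (v \<bullet> b) *\<^sub>R b)" by (simp only: euclidean_representation)
    also have "\<dots> = (\<Sum>b\<in>Basis. (v \<bullet> b) * h w b)"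
      by (simp add: linear_sum[OF lin2] linear_scale[OF lin2])
    also have "\<dots> = (\<Sum>b\<in>Basis. (T w \<bullet> b) * (v \<bullet> b))"
      by (intro sum.cong) (auto simp: TB)
    also have "\<dots> = T w \<bullet> v" by (rule euclidean_inner[symmetric])
    finally show ?thesis .
  qed
  have "linear T"
  proof (rule linearI)
    show "T (v + w) = T v + T w" for v w
      unfolding T_def linear_add[OF lin1] scaleR_add_left sum.distrib ..
    show "T (r *\<^sub>R v) = r *\<^sub>R T v" for r v
      unfolding T_def linear_scale[OF lin1] scaleR_sum_right by simp
  qed
  moreover have "inj T"
  proof -
    have "w = 0" if "T w = 0" for w
      using hT[of w w] pos[of w] that by force
    then show ?thesis using \<open>linear T\<close> linear_injective_0 by blast
  qed
  ultimately have "surj T" using linear_injective_imp_surjective by blast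
  then obtain w where w: "T w = (\<Sum>b\<in>Basis. l b *\<^sub>R b)" by (metis surjD)
  have "h w v = l v" for v
  proof -
    have "h w v = (\<Sum>b\<in>Basis. l b * (v \<bullet> b))"
      unfolding hT w inner_sum_left inner_scaleR_left by (simp add: inner_commute)
    also have "\<dots> = l (\<Sum>b\<in>Basis. (v \<bullet> b) *\<^sub>R b)"
      by (simp add: linear_sum[OF l] linear_scale[OF l] mult.commute)
    finally show ?thesis by (simp only: euclidean_representation)
  qed
  moreover have "w' = w" if "\<forall>v. h w' v = l v" for w'
  proof -
    have "T w' \<bullet> v = T w \<bullet> v" for v using that calculation hT by metis
    then have "T w' = T w" by (metis vector_eq_rdot)
    then show ?thesis using \<open>inj T\<close> by (auto dest: injD)
  qed
  ultimately show ?thesis by blast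
qed

lemma chart_inv_chart: "is_chart c \<Longrightarrow> x \<in> fst c \<Longrightarrow> chart_inv c (snd c x) = x"
  by (auto simp: is_chart_def homeomorphism_def)

lemma grad_eq:
  fixes A :: "('m::{t2_space, second_countable_topology}, 'n::finite) chart set"
  assumes M: "riemannian_manifold A g" and u: "Ck_function (Suc k) A u"
    and c: "c \<in> A" "x \<in> fst c"
  shows "g c x (grad g u c x) v = frechet_derivative (u \<circ> chart_inv c) (at (snd c x)) v"
proof -
  have "(u \<circ> chart_inv c) differentiable (at (snd c x))"
    using u c by (auto simp: Ck_function_def)
  then have l: "linear (frechet_derivative (u \<circ> chart_inv c) (at (snd c x)))"
    by (rule linear_frechet_derivative)
  have "bilinear (g c x)" "\<And>v. v \<noteq> 0 \<Longrightarrow> g c x v v > 0"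
    using M c by (auto simp: riemannian_manifold_def riemannian_metric_def)
  from theI'[OF metric_riesz[OF this l]] show ?thesis unfolding grad_def by blast
qed

lemma levi_civita_ex1:
  fixes A :: "('m::{t2_space, second_countable_topology}, 'n::finite) chart set"
  assumes M: "riemannian_manifold A g" and c: "c \<in> A" "x \<in> fst c"
  shows "\<exists>!\<Gamma>. levi_civita_at g c x \<Gamma>"
proof -
  define y where "y = snd c x"
  define h where "h = g c x"
  define d where "d z v w = frechet_derivative (\<lambda>y. g c (chart_inv c y) v w) (at y) z" for z v w
  have ch: "is_chart c" using M c by (auto simp: riemannian_manifold_def smooth_atlas_def)
  have yU: "y \<in> snd c ` fst c" using c by (auto simp: y_def)
  have opn: "open (snd c ` fst c)" using ch by (simp add: is_chart_def)
  have inU: "chart_inv c y' \<in> fst c" if "y' \<in> snd c ` fst c" for y'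
    using that chart_inv_chart[OF ch] by auto
  have gbil: "bilinear (g c p)" and gsym: "g c p v w = g c p w v" if "p \<in> fst c" for p v w
    using M c that by (auto simp: riemannian_manifold_def riemannian_metric_def)
  have pos: "\<And>v. v \<noteq> 0 \<Longrightarrow> h v v > 0" and h: "bilinear h" and hsym: "\<And>v w. h v w = h w v"
    using M c by (auto simp: riemannian_manifold_def riemannian_metric_def h_def)
  have diff: "(\<lambda>y. g c (chart_inv c y) v w) differentiable (at y)" for v w
  proof -
    have "Ck_on (Suc 0) (snd c ` fst c) (\<lambda>y. g c (chart_inv c y) v w)"
      using M c by (auto simp: riemannian_manifold_def riemannian_metric_def smooth_on_def
          simp del: Ck_on.simps)
    then show ?thesis using yU by auto
  qed
  have der: "((\<lambda>y. g c (chart_inv c y) v w) has_derivative (\<lambda>z. d z v w)) (at y)" for v w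
    using diff[of v w] unfolding d_def frechet_derivative_works by simp
  have dz: "linear (\<lambda>z. d z v w)" for v w
    using der has_derivative_linear by blast
  have uniq: "d z v w = D z"
    if D: "(f has_derivative D) (at y)"
      and f: "\<And>y'. y' \<in> snd c ` fst c \<Longrightarrow> f y' = g c (chart_inv c y') v w" for f D v w z
  proof -
    have "((\<lambda>y. g c (chart_inv c y) v w) has_derivative D) (at y)"
      by (rule has_derivative_transform_within_open[OF D opn yU]) (use f in auto)
    then show ?thesis using has_derivative_unique[OF der] by metis
  qed
  have dsym: "d z v w = d z w v" for z v w
    by (rule uniq[OF der]) (use gsym inU in auto)
  have dadd: "d z (v + v') w = d z v w + d z v' w" for z v v' w
    by (rule uniq[OF has_derivative_add[OF der der]]) (simp add: bilinear_ladd gbil inU)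
  have dsc: "d z (r *\<^sub>R v) w = r *\<^sub>R d z v w" for z r v w
    by (rule uniq[OF has_derivative_scaleR_right[OF der]]) (simp add: bilinear_lmul gbil inU)
  have dv: "linear (\<lambda>v. d z v w)" and dw: "linear (\<lambda>w. d z v w)" for z v w
  proof -
    show "linear (\<lambda>v. d z v w)" by (rule linearI) (simp_all only: dadd dsc)
    show "linear (\<lambda>w. d z v w)"
      by (rule linearI) (metis dsym dadd, metis dsym dsc)
  qed
  have simps: "h (v + v') w = h v w + h v' w" "h (r *\<^sub>R v) w = r * h v w"
    "h w (v + v') = h w v + h w v'" "h w (r *\<^sub>R v) = r * h w v" for v v' w r
    using bilinear_ladd[OF h] bilinear_lmul[OF h] bilinear_radd[OF h] bilinear_rmul[OF h] by auto
  define K where "K v w z = (d v w z + d w v z - d z v w) / 2" for v w z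
  have Klin: "linear (K v w)" for v w
    unfolding K_def
    by (rule linearI)
      (simp_all add: linear_add[OF dw] linear_add[OF dz] linear_scale[OF dw] linear_scale[OF dz]
        algebra_simps add_divide_distrib diff_divide_distrib)
  define \<Gamma> where "\<Gamma> v w = (THE t. \<forall>z. h t z = K v w z)" for v w
  have \<Gamma>: "h (\<Gamma> v w) z = K v w z" for v w z
    using theI'[OF metric_riesz[OF h pos Klin[of v w]]] unfolding \<Gamma>_def by blast
  have eqI: "s = t" if "\<And>z. h s z = h t z" for s t
  proof -
    have "linear (h t)" using h by (simp add: bilinear_def)
    from metric_riesz[OF h pos this] show ?thesis using that by metis
  qed
  have Gsym: "\<Gamma> v w = \<Gamma> w v" for v w
    by (rule eqI) (simp add: \<Gamma> K_def dsym[of _ v w])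
  have Gl: "linear (\<lambda>v. \<Gamma> v w)" for w
    by (rule linearI; rule eqI)
      (simp_all add: simps \<Gamma> K_def linear_add[OF dz] linear_add[OF dv] linear_scale[OF dz]
        linear_scale[OF dv] algebra_simps add_divide_distrib diff_divide_distrib)
  have "bilinear \<Gamma>"
    unfolding bilinear_def
  proof (intro conjI allI)
    fix v show "linear (\<lambda>w. \<Gamma> w v)" by (rule Gl)
    have "\<Gamma> v = (\<lambda>w. \<Gamma> w v)" using Gsym by auto
    then show "linear (\<Gamma> v)" using Gl by metis
  qed
  moreover have "d z v w = h (\<Gamma> z v) w + h v (\<Gamma> z w)" for z v w
    unfolding hsym[of v] \<Gamma> K_def using dsym[of z v w] dsym[of v z w] dsym[of w z v]
    by (simp add: field_simps)
  ultimately have ex: "levi_civita_at g c x \<Gamma>"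
    using Gsym unfolding levi_civita_at_def d_def h_def y_def by blast
  have "\<Delta> = \<Gamma>" if "levi_civita_at g c x \<Delta>" for \<Delta>
  proof (intro ext eqI)
    fix v w z
    have D: "\<Delta> v w = \<Delta> w v" "d z v w = h (\<Delta> z v) w + h v (\<Delta> z w)" for z v w
      using that unfolding levi_civita_at_def d_def h_def y_def by blast+
    have "h (\<Delta> v w) z = K v w z"
      unfolding K_def D(2) using D(1)[of w v] D(1)[of v z] D(1)[of w z] hsym[of w "\<Delta> z v"]
      by simp
    then show "h (\<Delta> v w) z = h (\<Gamma> v w) z" by (simp add: \<Gamma>)
  qed
  then show ?thesis using ex by blast
qed

end

theory Submission
  imports Defs
begin

text \<open>If \<open>u\<close> attains its supremum, a maximum point serves as constant sequence. Otherwise let \<open>x\<close>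
  maximise \<open>u - \<epsilon> \<phi>(\<gamma>)\<close>, which is possible since \<open>\<phi>(\<gamma>)\<close> dominates \<open>u\<close> at infinity; as \<open>\<epsilon> \<rightarrow> 0\<close> the
  values \<open>u(x)\<close> tend to the supremum, so \<open>x\<close> leaves every compact set. Since \<open>\<phi>\<close> is concave, \<open>x\<close>
  also maximises \<open>u - \<lambda> \<gamma>\<close> with \<open>\<lambda> = \<epsilon> \<phi>'(\<gamma>(x))\<close>; no second derivative of \<open>\<phi>\<close> is required. Hence
  \<open>grad u = \<lambda> grad \<gamma>\<close> and \<open>hess u \<le> \<lambda> hess \<gamma>\<close> at \<open>x\<close>, so that \<open>Tr (P \<circ> hess u) \<le> \<lambda> Tr (P \<circ> hess \<gamma>)\<close>
  because \<open>P\<close> is a sum of rank-one operators \<open>p \<otimes> p\<close>. As \<open>\<phi>' = 1 / (sqrt G (\<integral> 1 / sqrt G + 1))\<close>, the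
  hypotheses on \<open>\<gamma>\<close> bound \<open>|grad u|\<close> and \<open>Lu\<close> at \<open>x\<close> by multiples of \<open>\<epsilon>\<close>.\<close>

section \<open>Traces against positive semi-definite operators\<close>

text \<open>The quadratic polynomial \<open>b (v + t w) (v + t w)\<close> in \<open>t\<close> is
  nonnegative. As \<open>b\<close> may be degenerate, a vanishing leading coefficient is treated
  separately.\<close>

lemma psd_cauchy_schwarz:
  fixes b :: "'a::real_vector \<Rightarrow> 'a \<Rightarrow> real"
  assumes b: "bilinear b" and sym: "\<And>v w. b v w = b w v" and psd: "\<And>v. b v v \<ge> 0"
  shows "(b v w)\<^sup>2 \<le> b v v * b w w"
proof -
  have q: "0 \<le> b v v + 2 * t * b v w + t\<^sup>2 * b w w" for t
    using psd[of "v + t *\<^sub>R w"] sym[of w v]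
    by (simp add: bilinear_ladd[OF b] bilinear_radd[OF b] bilinear_lmul[OF b] bilinear_rmul[OF b]
        power2_eq_square algebra_simps)
  show ?thesis
  proof (cases "b w w = 0")
    case True
    have "b v w = 0"
    proof (rule ccontr)
      assume "b v w \<noteq> 0"
      \<comment> \<open>This \<open>t\<close> makes the remaining affine function
        \<open>b v v + 2 * t * b v w\<close> equal to -1.\<close>
      then show False using q[of "- (b v v + 1) / (2 * b v w)"] True by (simp add: field_simps)
    qed
    then show ?thesis using True by simp
  next
    case False
    then have pos: "b w w > 0" using psd[of w] by simp
    then have "0 \<le> b v v - (b v w)\<^sup>2 / b w w"
      using q[of "- b v w / b w w"] by (simp add: power2_eq_square field_simps)
    then show ?thesis using pos by (simp add: field_simps)
  qed
qed

text \<open>Symmetric Gaussian elimination, one basis vector at a time; this replaces the spectral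
  theorem.\<close>

lemma psd_sum_of_squares:
  fixes b :: "'a::euclidean_space \<Rightarrow> 'a \<Rightarrow> real"
  assumes "bilinear b" and "\<And>v w. b v w = b w v" and "\<And>v. b v v \<ge> 0"
  shows "\<exists>L. (\<forall>l\<in>set L. linear l) \<and> (\<forall>v w. b v w = (\<Sum>l\<leftarrow>L. l v * l w))"
proof -
  \<comment> \<open>\<open>S\<close> contains all basis vectors whose row of \<open>b\<close> can be
    nonzero. The form \<open>b\<close> varies in the induction because each pivot changes
    it.\<close>
  have "\<exists>L. (\<forall>l\<in>set L. linear l) \<and> (\<forall>v w. b v w = (\<Sum>l\<leftarrow>L. l v * l w))"
    if "finite S" "\<forall>e\<in>Basis - S. \<forall>w. b e w = 0" "bilinear b" "\<forall>v w. b v w = b w v" "\<forall>v. b v v \<ge> 0"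
    for S and b :: "'a \<Rightarrow> 'a \<Rightarrow> real"
    using that
  proof (induction S arbitrary: b rule: finite_induct)
    case empty
    have "b v w = 0" for v w
    proof -
      have "linear (\<lambda>v. b v w)" using empty(2) unfolding bilinear_def by blast
      then show ?thesis
        using linear_eq_stdbasis[of "\<lambda>v. b v w" "\<lambda>_. 0"] empty by (auto simp: linear_iff fun_eq_iff)
    qed
    then show ?case by (intro exI[of _ "[]"]) simp
  next
    case (insert e S)
    note b = insert.prems(2) and sym = insert.prems(3) and psd = insert.prems(4)
    note cs = psd_cauchy_schwarz[OF b, OF sym[rule_format] psd[rule_format]]
    show ?case
    proof (cases "b e e = 0")
      case True
      \<comment> \<open>A zero pivot forces its whole row to vanish, by Cauchy-Schwarz.\<close>
      then have "b e w = 0" for w using cs[of e w] by simp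
      then show ?thesis using insert.prems by (intro insert.IH) auto
    next
      case False
      then have pos: "b e e > 0" using psd by (simp add: less_le)
      have lin: "linear (b e)" using b by (simp add: bilinear_def)
      \<comment> \<open>The Schur complement of the pivot: its row at \<open>e\<close> vanishes, and
        Cauchy-Schwarz is exactly its semi-definiteness.\<close>
      define b' where "b' v w = b v w - b e v * b e w / b e e" for v w
      have b'e: "b' e w = 0" for w using pos by (simp add: b'_def)
      have "\<exists>L. (\<forall>l\<in>set L. linear l) \<and> (\<forall>v w. b' v w = (\<Sum>l\<leftarrow>L. l v * l w))"
      proof (rule insert.IH)
        show "bilinear b'"
          unfolding bilinear_def linear_iff b'_def
          by (simp add: bilinear_ladd[OF b] bilinear_radd[OF b] bilinear_lmul[OF b]
              bilinear_rmul[OF b] algebra_simps add_divide_distrib diff_divide_distrib)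
        show "\<forall>v w. b' v w = b' w v" using sym by (simp add: b'_def mult.commute)
        show "\<forall>v. 0 \<le> b' v v"
          using cs[of e] pos by (simp add: b'_def field_simps power2_eq_square)
        have "b' e' w = 0" if "e' \<in> Basis - S" for e' w
        proof (cases "e' = e")
          case False
          then have "\<forall>w. b e' w = 0" using that insert.prems(1) by blast
          then show ?thesis using sym by (metis b'_def diff_0_right div_0 mult_zero_left)
        qed (simp add: b'e)
        then show "\<forall>e\<in>Basis - S. \<forall>w. b' e w = 0" by blast
      qed
      then obtain L where L: "\<forall>l\<in>set L. linear l" "\<And>v w. b' v w = (\<Sum>l\<leftarrow>L. l v * l w)" by blast
      define l0 where "l0 v = b e v / sqrt (b e e)" for v
      have "linear l0"
        using lin by (simp add: l0_def linear_iff add_divide_distrib)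
      moreover have "b v w = l0 v * l0 w + b' v w" for v w
        using pos by (simp add: l0_def b'_def)
      ultimately show ?thesis using L by (intro exI[of _ "l0 # L"]) auto
    qed
  qed
  from this[of Basis b] show ?thesis using assms by simp
qed

text \<open>Splitting \<open>h (P v) w\<close> into products \<open>l v * l w\<close> and
  representing each \<open>l\<close> by a vector \<open>p\<close> splits \<open>P\<close> into the
  operators that send \<open>v\<close> to \<open>h p v\<close> times \<open>p\<close>; composed with
  \<open>H\<close>, such an operator has trace \<open>h (H p) p\<close>. The list \<open>ps\<close>
  is fixed before \<open>H\<close>, so that one list serves two Hessians.\<close>

lemma trace_psd_comp:
  fixes h :: "real ^ 'n::finite \<Rightarrow> real ^ 'n \<Rightarrow> real"
  assumes h: "bilinear h" and hsym: "\<And>v w. h v w = h w v" and pos: "\<And>v. v \<noteq> 0 \<Longrightarrow> h v v > 0"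
    and P: "linear P" and Psym: "\<And>v w. h (P v) w = h v (P w)" and Ppsd: "\<And>v. h (P v) v \<ge> 0"
  obtains ps where "\<And>H. linear H \<Longrightarrow> trace (matrix (P \<circ> H)) = (\<Sum>p\<leftarrow>ps. h (H p) p)"
proof -
  have bil: "bilinear (\<lambda>v w. h (P v) w)"
    unfolding bilinear_def linear_iff
    by (simp add: linear_add[OF P] linear_scale[OF P] bilinear_ladd[OF h] bilinear_radd[OF h]
        bilinear_lmul[OF h] bilinear_rmul[OF h])
  have "h (P v) w = h (P w) v" for v w by (subst Psym) (rule hsym)
  from psd_sum_of_squares[OF bil this Ppsd]
  obtain L where L: "\<forall>l\<in>set L. linear l" "\<And>v w. h (P v) w = (\<Sum>l\<leftarrow>L. l v * l w)" by blast
  define r where "r l = (THE w. \<forall>v. h w v = l v)" for l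
  have r: "h (r l) v = l v" if "l \<in> set L" for l v
    using theI'[OF metric_riesz[OF h pos, of l]] L(1) that unfolding r_def by blast
  have hl: "linear (\<lambda>v. h v w)" and hr: "linear (h w)" for w using h by (auto simp: bilinear_def)
  have eqI: "s = t" if "\<And>z. h s z = h t z" for s t
    using metric_riesz[OF h pos hr[of t]] that by metis
  have hsum: "h (\<Sum>l\<leftarrow>xs. k l *\<^sub>R r l) w = (\<Sum>l\<leftarrow>xs. k l * h (r l) w)" for k w xs
    by (induction xs) (simp_all add: linear_0[OF hl] linear_add[OF hl] linear_scale[OF hl])
  have Pv: "P v = (\<Sum>l\<leftarrow>L. l v *\<^sub>R r l)" for v
  proof (rule eqI)
    fix w
    show "h (P v) w = h (\<Sum>l\<leftarrow>L. l v *\<^sub>R r l) w"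
      unfolding hsum L(2) using r by (intro arg_cong[of _ _ sum_list] map_cong) auto
  qed
  have comp: "(\<Sum>l\<leftarrow>xs. f l *\<^sub>R r l) $ i = (\<Sum>l\<leftarrow>xs. f l * r l $ i)" for f xs i
    by (induction xs) simp_all
  have swap: "(\<Sum>i\<in>UNIV. \<Sum>l\<leftarrow>xs. f i l) = (\<Sum>l\<leftarrow>xs. \<Sum>i\<in>UNIV. f i l)"
    for f :: "'n \<Rightarrow> (real ^ 'n \<Rightarrow> real) \<Rightarrow> real" and xs
    by (induction xs) (simp_all add: sum.distrib)
  have "trace (matrix (P \<circ> H)) = (\<Sum>p\<leftarrow>map r L. h (H p) p)" if H: "linear H" for H
  proof -
    have "trace (matrix (P \<circ> H)) = (\<Sum>l\<leftarrow>L. \<Sum>i\<in>UNIV. l (H (axis i 1)) * r l $ i)"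
      by (simp add: trace_def matrix_def Pv comp swap)
    also have "\<dots> = (\<Sum>l\<leftarrow>L. h (H (r l)) (r l))"
    proof (intro arg_cong[of _ _ sum_list] map_cong refl)
      fix l assume l: "l \<in> set L"
      have ll: "linear (\<lambda>v. l (H v))"
        using linear_compose[OF H, of l] L(1) l by (simp add: comp_def)
      have "(\<Sum>i\<in>UNIV. l (H (axis i 1)) * r l $ i) = (\<Sum>i\<in>UNIV. l (H (r l $ i *\<^sub>R axis i 1)))"
        by (simp add: linear_scale[OF ll] mult.commute)
      also have "\<dots> = l (H (\<Sum>i\<in>UNIV. r l $ i *\<^sub>R axis i 1))"
        by (simp add: linear_sum[OF ll])
      also have "(\<Sum>i\<in>UNIV. r l $ i *\<^sub>R axis i 1) = r l"
        using basis_expansion[of "r l"] by (simp add: scalar_mult_eq_scaleR)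
      also have "l (H (r l)) = h (H (r l)) (r l)" using r[OF l] hsym by metis
      finally show "(\<Sum>i\<in>UNIV. l (H (axis i 1)) * r l $ i) = h (H (r l)) (r l)" .
    qed
    finally show ?thesis by (simp add: comp_def)
  qed
  then show thesis by (rule that)
qed


section \<open>Calculus\<close>

lemma differentiable_prod_real:
  fixes f :: "'i \<Rightarrow> 'a::real_normed_vector \<Rightarrow> real"
  assumes "\<And>i. i \<in> I \<Longrightarrow> f i differentiable (at x)"
  shows "(\<lambda>y. \<Prod>i\<in>I. f i y) differentiable (at x)"
  using assms by (induction I rule: infinite_finite_induct) (auto intro: differentiable_mult)

lemma differentiable_det:
  fixes B :: "'a::real_normed_vector \<Rightarrow> real ^ 'n::finite ^ 'n"
  assumes "\<And>i j. (\<lambda>y. B y $ i $ j) differentiable (at x)"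
  shows "(\<lambda>y. det (B y)) differentiable (at x)"
  unfolding det_def
  by (intro differentiable_sum ballI differentiable_mult differentiable_prod_real assms
      differentiable_const) (simp add: finite_permutations)

text \<open>By Cramer's rule \<open>X\<close> is a quotient of determinants in the entries of
  \<open>B\<close> and \<open>r\<close>. This gives regularity of a field that is known only through
  linear equations.\<close>

lemma differentiable_linear_system:
  fixes B :: "'a::real_normed_vector \<Rightarrow> real ^ 'n::finite ^ 'n" and X :: "'a \<Rightarrow> real ^ 'n"
  assumes S: "open S" "x \<in> S"
    and B: "\<And>i j. (\<lambda>y. B y $ i $ j) differentiable (at x)"
    and r: "\<And>i. (\<lambda>y. r y $ i) differentiable (at x)"
    and sol: "\<And>y. y \<in> S \<Longrightarrow> B y *v X y = r y"
    and det: "\<And>y. y \<in> S \<Longrightarrow> det (B y) \<noteq> 0"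
  shows "X differentiable (at x)"
proof -
  define Y where "Y y = (\<chi> k. det (\<chi> i j. if j = k then r y $ i else B y $ i $ j) / det (B y))" for y
  have "Y differentiable (at x)"
  proof (subst differentiable_componentwise_within, intro ballI)
    fix b :: "real ^ 'n" assume "b \<in> Basis"
    then obtain k where k: "b = axis k 1" by (auto simp: Basis_vec_def)
    have "(\<lambda>y. det (\<chi> i j. if j = k then r y $ i else B y $ i $ j) / det (B y)) differentiable (at x)"
    proof (intro differentiable_divide differentiable_det B)
      fix i j show "(\<lambda>y. (\<chi> i j. if j = k then r y $ i else B y $ i $ j) $ i $ j) differentiable (at x)"
        by (cases "j = k") (simp_all add: r B)
    qed (use det S in auto)
    then show "(\<lambda>y. Y y \<bullet> b) differentiable (at x)"
      by (simp add: Y_def k inner_axis)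
  qed
  then obtain D where "(Y has_derivative D) (at x)" unfolding differentiable_def by blast
  moreover have "Y y = X y" if "y \<in> S" for y
    using sol[OF that] unfolding cramer[OF det[OF that]] Y_def by simp
  ultimately have "(X has_derivative D) (at x)"
    using has_derivative_transform_within_open[OF _ S, of Y D UNIV X] by simp
  then show ?thesis unfolding differentiable_def by blast
qed

text \<open>If \<open>D > 0\<close>, then \<open>f'\<close> is positive just to the right of
  \<open>0\<close>, and the mean value theorem makes \<open>f\<close> exceed \<open>f 0\<close>
  there.\<close>

lemma second_derivative_nonpos_at_max:
  fixes f :: "real \<Rightarrow> real"
  assumes d: "d > 0" and f: "\<And>t. \<bar>t\<bar> < d \<Longrightarrow> (f has_real_derivative f' t) (at t)"
    and f'0: "f' 0 = 0" and f'': "(f' has_real_derivative D) (at 0)"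
    and max: "\<And>t. \<bar>t\<bar> < d \<Longrightarrow> f t \<le> f 0"
  shows "D \<le> 0"
proof (rule ccontr)
  assume "\<not> D \<le> 0"
  then obtain e where e: "e > 0" "\<And>h. 0 < h \<Longrightarrow> h < e \<Longrightarrow> f' 0 < f' (0 + h)"
    using DERIV_pos_inc_right[OF f''] by auto
  define t where "t = min d e / 2"
  have t: "0 < t" "t < d" "t < e" using d e by (auto simp: t_def)
  have "\<exists>z. 0 < z \<and> z < t \<and> f t - f 0 = (t - 0) * f' z"
    by (rule MVT2) (use t f in auto)
  then obtain z where "0 < z" "z < t" "f t - f 0 = t * f' z" by auto
  then have "f t > f 0" using e(2)[of z] t f'0
    by (metis add_0 diff_gt_0_iff_gt mult_pos_pos order_less_trans)
  then show False using max[of t] t by simp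
qed

text \<open>The first-order part is Fermat's criterion for \<open>u - k v\<close>; the second-order
  part is the one-variable test along the line \<open>x + t p\<close>, hence an inequality for the
  pair of directions \<open>p\<close>, \<open>p\<close> only.\<close>

lemma Ck_on_2_max:
  fixes u v :: "'a::euclidean_space \<Rightarrow> real"
  assumes u: "Ck_on 2 S u" and v: "Ck_on 2 S v" and S: "open S" "x \<in> S"
    and max: "\<And>y. y \<in> S \<Longrightarrow> u y - k * v y \<le> u x - k * v x"
  shows "frechet_derivative u (at x) p = k * frechet_derivative v (at x) p"
    and "frechet_derivative (\<lambda>y. frechet_derivative u (at y) p) (at x) p
           \<le> k * frechet_derivative (\<lambda>y. frechet_derivative v (at y) p) (at x) p"
proof -
  have D: "(u has_derivative frechet_derivative u (at y)) (at y)"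
    "(v has_derivative frechet_derivative v (at y)) (at y)" if "y \<in> S" for y
    using u v that by (auto simp: numeral_2_eq_2 frechet_derivative_works[symmetric])
  have D2: "((\<lambda>y. frechet_derivative u (at y) p) has_derivative
               frechet_derivative (\<lambda>y. frechet_derivative u (at y) p) (at x)) (at x)"
    "((\<lambda>y. frechet_derivative v (at y) p) has_derivative
               frechet_derivative (\<lambda>y. frechet_derivative v (at y) p) (at x)) (at x)"
    using u v S by (auto simp: numeral_2_eq_2 frechet_derivative_works[symmetric])
  define W where "W y q = frechet_derivative u (at y) q - k * frechet_derivative v (at y) q" for y q
  define W2 where "W2 q = frechet_derivative (\<lambda>y. frechet_derivative u (at y) p) (at x) q
           - k * frechet_derivative (\<lambda>y. frechet_derivative v (at y) p) (at x) q" for q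
  have DW: "((\<lambda>y. u y - k * v y) has_derivative W y) (at y)" if "y \<in> S" for y
    unfolding W_def by (intro derivative_intros D that)
  have DW2: "((\<lambda>y. W y p) has_derivative W2) (at x)"
    unfolding W_def W2_def by (intro derivative_intros D2)
  have W0: "W x = (\<lambda>_. 0)"
    by (rule differential_zero_maxmin[OF S(2,1) DW[OF S(2)]]) (use max in auto)
  then show "frechet_derivative u (at x) p = k * frechet_derivative v (at x) p"
    unfolding W_def by (metis eq_iff_diff_eq_0)
  obtain r where r: "r > 0" "ball x r \<subseteq> S" using S open_contains_ball by blast
  \<comment> \<open>Chosen so that \<open>x + t p\<close> stays in the ball of radius
    \<open>r\<close>; the summand 1 covers \<open>p = 0\<close>.\<close>
  define d where "d = r / (norm p + 1)"
  have d: "d > 0" using r by (simp add: d_def add_nonneg_pos)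
  have inS: "x + t *\<^sub>R p \<in> S" if "\<bar>t\<bar> < d" for t
  proof -
    have "\<bar>t\<bar> * norm p \<le> \<bar>t\<bar> * (norm p + 1)" by (simp add: mult_left_mono)
    also have "\<dots> < r" using that by (simp add: d_def pos_less_divide_eq add_nonneg_pos)
    finally show ?thesis using r(2) by (auto simp: dist_norm)
  qed
  have line: "((\<lambda>t. x + t *\<^sub>R p) has_derivative (\<lambda>s. s *\<^sub>R p)) (at t)" for t
    by (auto intro!: derivative_eq_intros)
  have chain: "((\<lambda>t. F (x + t *\<^sub>R p)) has_real_derivative F' p) (at t)"
    if "(F has_derivative F') (at (x + t *\<^sub>R p))" for F F' and t :: real
  proof -
    have "((\<lambda>t. F (x + t *\<^sub>R p)) has_derivative (\<lambda>s. F' (s *\<^sub>R p))) (at t)"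
      using has_derivative_compose[OF line that] .
    moreover have "(\<lambda>s. F' (s *\<^sub>R p)) = (*) (F' p)"
      using linear_scale[OF has_derivative_linear[OF that]] by (auto simp: mult.commute)
    ultimately show ?thesis by (simp add: has_field_derivative_def)
  qed
  have "W2 p \<le> 0"
  proof (rule second_derivative_nonpos_at_max[OF d])
    show "((\<lambda>t. u (x + t *\<^sub>R p) - k * v (x + t *\<^sub>R p)) has_real_derivative W (x + t *\<^sub>R p) p) (at t)"
      if "\<bar>t\<bar> < d" for t
      using chain[OF DW[OF inS[OF that]]] .
    show "W (x + 0 *\<^sub>R p) p = 0" by (simp add: W0)
    show "((\<lambda>t. W (x + t *\<^sub>R p) p) has_real_derivative W2 p) (at 0)"
      by (rule chain) (use DW2 in simp)
  qed (use max inS in simp)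
  then show "frechet_derivative (\<lambda>y. frechet_derivative u (at y) p) (at x) p
           \<le> k * frechet_derivative (\<lambda>y. frechet_derivative v (at y) p) (at x) p"
    by (simp add: W2_def)
qed


section \<open>The maximum principle in charts\<close>

text \<open>Smoothness of the metric is given for fixed arguments only. Expanding a varying argument
  along the axes leaves such coefficients, to which the product rule applies.\<close>

lemma bilinear_axis_expansion:
  fixes h :: "real ^ 'n::finite \<Rightarrow> real ^ 'n \<Rightarrow> real"
  assumes "bilinear h"
  shows "h w v = (\<Sum>i\<in>UNIV. w $ i * h (axis i 1) v)"
proof -
  have lin: "linear (\<lambda>w. h w v)" using assms by (simp add: bilinear_def)
  have "h w v = h (\<Sum>i\<in>UNIV. w $ i *\<^sub>R axis i 1) v"
    using basis_expansion[of w] by (simp add: scalar_mult_eq_scaleR)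
  then show ?thesis by (simp add: linear_sum[OF lin] linear_scale[OF lin])
qed

section \<open>Charts, continuity, and differentiability of the gradient\<close>

lemma chart_at_in:
  assumes "riemannian_manifold A g"
  shows "chart_at A x \<in> A" and "x \<in> fst (chart_at A x)"
proof -
  have "x \<in> (\<Union>c\<in>A. fst c)"
    using assms by (simp add: riemannian_manifold_def smooth_atlas_def)
  then have "\<exists>c. c \<in> A \<and> x \<in> fst c" by blast
  from someI_ex[OF this] show "chart_at A x \<in> A" "x \<in> fst (chart_at A x)"
    by (simp_all add: chart_at_def)
qed

lemma riemannian_manifold_chart:
  assumes "riemannian_manifold A g" "c \<in> A"
  shows "is_chart c" and "open (fst c)" and "open (snd c ` fst c)"
    and "continuous_on (fst c) (snd c)"
    and "\<And>y. y \<in> snd c ` fst c \<Longrightarrow> chart_inv c y \<in> fst c \<and> snd c (chart_inv c y) = y"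
proof -
  show ch: "is_chart c" using assms by (auto simp: riemannian_manifold_def smooth_atlas_def)
  then show "open (fst c)" "open (snd c ` fst c)" "continuous_on (fst c) (snd c)"
    by (auto simp: is_chart_def homeomorphism_def)
  show "\<And>y. y \<in> snd c ` fst c \<Longrightarrow> chart_inv c y \<in> fst c \<and> snd c (chart_inv c y) = y"
    using chart_inv_chart[OF ch] by auto
qed

lemma Ck_function_continuous:
  assumes M: "riemannian_manifold A g" and u: "Ck_function (Suc k) A u"
  shows "continuous_on UNIV u"
proof (rule continuous_at_imp_continuous_on, intro ballI)
  fix x
  define c where "c = chart_at A x"
  have c: "c \<in> A" "x \<in> fst c" using chart_at_in[OF M] by (auto simp: c_def)
  note ch = riemannian_manifold_chart[OF M c(1)]
  have "continuous_on (snd c ` fst c) (u \<circ> chart_inv c)"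
  proof (intro continuous_at_imp_continuous_on ballI)
    fix y assume "y \<in> snd c ` fst c"
    then have "(u \<circ> chart_inv c) differentiable (at y)"
      using u c by (auto simp: Ck_function_def)
    then show "isCont (u \<circ> chart_inv c) y" by (rule differentiable_imp_continuous_within)
  qed
  then have "continuous_on (fst c) ((u \<circ> chart_inv c) \<circ> snd c)"
    by (rule continuous_on_compose[OF ch(4)])
  moreover have "((u \<circ> chart_inv c) \<circ> snd c) y = u y" if "y \<in> fst c" for y
    using chart_inv_chart[OF ch(1) that] by simp
  ultimately have "continuous_on (fst c) u" by (metis (no_types, lifting) continuous_on_cong)
  then show "isCont u x" using ch(2) c(2) continuous_on_eq_continuous_at by blast
qed

lemma metric_at:
  assumes "riemannian_manifold A g" "c \<in> A" "x \<in> fst c"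
  shows "bilinear (g c x)" and "g c x v w = g c x w v" and "v \<noteq> 0 \<Longrightarrow> g c x v v > 0"
    and "g c x v v \<ge> 0"
proof -
  show *: "bilinear (g c x)" "g c x v w = g c x w v" "v \<noteq> 0 \<Longrightarrow> g c x v v > 0" for v w
    using assms by (auto simp: riemannian_manifold_def riemannian_metric_def)
  show "g c x v v \<ge> 0"
    using *(3)[of v] bilinear_lzero[OF *(1), of v] by (cases "v = 0") auto
qed

text \<open>The gradient is defined by a description; its regularity comes from the linear system
  whose matrix is the Gram matrix of the metric and whose right-hand side consists of the partial
  derivatives of \<open>u\<close>.\<close>

lemma grad_differentiable:
  fixes A :: "('m::{t2_space, second_countable_topology}, 'n::finite) chart set"
  assumes M: "riemannian_manifold A g" and u: "Ck_function 2 A u"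
    and c: "c \<in> A" "x \<in> fst c"
  shows "(grad g u c \<circ> chart_inv c) differentiable (at (snd c x))"
proof -
  note ch = riemannian_manifold_chart[OF M c(1)]
  define U where "U = snd c ` fst c"
  define B where "B y = (\<chi> i j. g c (chart_inv c y) (axis j 1) (axis i 1))" for y
  define r where "r y = (\<chi> i. frechet_derivative (u \<circ> chart_inv c) (at y) (axis i 1))" for y
  have U: "open U" "snd c x \<in> U" using ch(3) c by (auto simp: U_def)
  have inU: "chart_inv c y \<in> fst c" "snd c (chart_inv c y) = y" if "y \<in> U" for y
    using ch(5) that by (auto simp: U_def)
  have Bw: "(B y *v w) $ i = g c (chart_inv c y) w (axis i 1)" if "y \<in> U" for y w i
    using bilinear_axis_expansion[OF metric_at(1)[OF M c(1) inU(1)[OF that]], of w "axis i 1"]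
    by (simp add: B_def matrix_vector_mult_def mult.commute)
  show ?thesis
  proof (rule differentiable_linear_system[OF U])
    fix i j
    have "Ck_on (Suc 0) U (\<lambda>y. g c (chart_inv c y) (axis j 1) (axis i 1))"
      using M c by (auto simp: riemannian_manifold_def riemannian_metric_def smooth_on_def U_def
          simp del: Ck_on.simps)
    then show "(\<lambda>y. B y $ i $ j) differentiable (at (snd c x))" using U by (simp add: B_def)
  next
    fix i
    show "(\<lambda>y. r y $ i) differentiable (at (snd c x))"
      using u c(1) U(2) unfolding r_def U_def by (auto simp: Ck_function_def numeral_2_eq_2)
  next
    fix y assume y: "y \<in> U"
    note m = metric_at[OF M c(1) inU(1)[OF y]]
    show "B y *v (grad g u c \<circ> chart_inv c) y = r y"
      using grad_eq[OF M u[unfolded numeral_2_eq_2] c(1) inU(1)[OF y]] inU(2)[OF y]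
      by (simp add: vec_eq_iff Bw[OF y] r_def)
    \<comment> \<open>The Gram matrix has no kernel: such a \<open>w\<close> is orthogonal to every
      axis vector, hence to itself.\<close>
    have "w = 0" if "B y *v w = 0" for w
    proof -
      have "g c (chart_inv c y) (axis i 1) w = 0" for i
        using Bw[OF y, of w i] m(2) that by simp
      then have "g c (chart_inv c y) w w = 0"
        using bilinear_axis_expansion[OF m(1), of w w] by simp
      then show ?thesis using m(3)[of w] by fastforce
    qed
    then have "inj ((*v) (B y))"
      using linear_injective_0[OF matrix_vector_mul_linear[of "B y"]] by blast
    then show "det (B y) \<noteq> 0"
      using invertible_det_nz invertible_left_inverse matrix_left_invertible_injective by blast
  qed
qed

section \<open>Christoffel symbols and the Hessian in a chart\<close>

lemma christoffel:
  fixes A :: "('m::{t2_space, second_countable_topology}, 'n::finite) chart set"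
  assumes "riemannian_manifold A g" "c \<in> A" "x \<in> fst c"
  shows "levi_civita_at g c x (christoffel g c x)"
  using theI'[OF levi_civita_ex1[OF assms]] by (simp add: christoffel_def)

lemma linear_hess:
  fixes A :: "('m::{t2_space, second_countable_topology}, 'n::finite) chart set"
  assumes M: "riemannian_manifold A g" and u: "Ck_function 2 A u"
    and c: "c \<in> A" "x \<in> fst c"
  shows "linear (hess g u c x)"
proof -
  have "linear (frechet_derivative (grad g u c \<circ> chart_inv c) (at (snd c x)))"
    using linear_frechet_derivative[OF grad_differentiable[OF assms]] .
  moreover have "linear (\<lambda>v. christoffel g c x v (grad g u c x))"
    using christoffel[OF M c] by (simp add: levi_civita_at_def bilinear_def)
  ultimately have "linear (\<lambda>v. frechet_derivative (grad g u c \<circ> chart_inv c) (at (snd c x)) v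
      + christoffel g c x v (grad g u c x))"
    by (rule linear_compose_add)
  then show ?thesis by (simp add: hess_def cov_deriv_def[abs_def])
qed

text \<open>Differentiate the identity between \<open>g (grad u) v\<close> and the derivative of
  \<open>u\<close> in the constant direction \<open>v\<close>, and use the compatibility of the
  connection with the metric. The resulting correction term involves only the first derivative of
  \<open>u\<close>.\<close>

lemma metric_hess:
  fixes A :: "('m::{t2_space, second_countable_topology}, 'n::finite) chart set"
  assumes M: "riemannian_manifold A g" and u: "Ck_function 2 A u"
    and c: "c \<in> A" "x \<in> fst c"
  shows "g c x (hess g u c x z) v =
    frechet_derivative (\<lambda>y. frechet_derivative (u \<circ> chart_inv c) (at y) v) (at (snd c x)) z
    - frechet_derivative (u \<circ> chart_inv c) (at (snd c x)) (christoffel g c x z v)"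
proof -
  note ch = riemannian_manifold_chart[OF M c(1)]
  note m = metric_at[OF M c]
  define U where "U = snd c ` fst c"
  define y0 where "y0 = snd c x"
  define X where "X = grad g u c \<circ> chart_inv c"
  define \<Gamma> where "\<Gamma> = christoffel g c x"
  have U: "open U" "y0 \<in> U" using ch(3) c by (auto simp: U_def y0_def)
  have y0: "chart_inv c y0 = x" using chart_inv_chart[OF ch(1) c(2)] by (simp add: y0_def)
  have inU: "chart_inv c y \<in> fst c" "snd c (chart_inv c y) = y" if "y \<in> U" for y
    using ch(5) that by (auto simp: U_def)
  have DX: "(X has_derivative frechet_derivative X (at y0)) (at y0)"
    using grad_differentiable[OF assms] unfolding X_def y0_def frechet_derivative_works .
  have \<Gamma>: "bilinear \<Gamma>" and dg: "frechet_derivative (\<lambda>y. g c (chart_inv c y) v w) (at y0) z =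
      g c x (\<Gamma> z v) w + g c x v (\<Gamma> z w)" for z v w
    using christoffel[OF M c] unfolding levi_civita_at_def \<Gamma>_def y0_def by blast+
  have Dg: "((\<lambda>y. g c (chart_inv c y) v w) has_derivative
      (\<lambda>z. g c x (\<Gamma> z v) w + g c x v (\<Gamma> z w))) (at y0)" for v w
  proof -
    have "Ck_on (Suc 0) U (\<lambda>y. g c (chart_inv c y) v w)"
      using M c by (auto simp: riemannian_manifold_def riemannian_metric_def smooth_on_def U_def
          simp del: Ck_on.simps)
    then have "(\<lambda>y. g c (chart_inv c y) v w) differentiable (at y0)" using U by simp
    then show ?thesis unfolding frechet_derivative_works by (simp add: dg[abs_def])
  qed
  \<comment> \<open>The product rule for the pairing of \<open>X\<close> with \<open>v\<close>, with
    \<open>X\<close> expanded along the axes.\<close>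
  define D where "D z = (\<Sum>i\<in>UNIV. X y0 $ i * (g c x (\<Gamma> z (axis i 1)) v + g c x (axis i 1) (\<Gamma> z v))
      + frechet_derivative X (at y0) z $ i * g c x (axis i 1) v)" for z
  have "((\<lambda>y. \<Sum>i\<in>UNIV. X y $ i * g c (chart_inv c y) (axis i 1) v) has_derivative D) (at y0)"
  proof -
    have DXi: "((\<lambda>y. X y $ i) has_derivative (\<lambda>z. frechet_derivative X (at y0) z $ i)) (at y0)" for i
      using bounded_linear.has_derivative[OF bounded_linear_vec_nth DX] .
    show ?thesis unfolding D_def
      by (intro has_derivative_sum) (use has_derivative_mult[OF DXi Dg] in \<open>simp add: y0\<close>)
  qed
  \<comment> \<open>On the whole chart image the sum is the derivative of \<open>u\<close> in
    direction \<open>v\<close>, so \<open>D\<close> differentiates that as well.\<close>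
  moreover have "(\<Sum>i\<in>UNIV. X y $ i * g c (chart_inv c y) (axis i 1) v)
      = frechet_derivative (u \<circ> chart_inv c) (at y) v" if "y \<in> U" for y
    using grad_eq[OF M u[unfolded numeral_2_eq_2] c(1) inU(1)[OF that], of v] inU(2)[OF that]
      bilinear_axis_expansion[OF metric_at(1)[OF M c(1) inU(1)[OF that]], of "X y" v]
    by (simp add: X_def)
  ultimately have "((\<lambda>y. frechet_derivative (u \<circ> chart_inv c) (at y) v) has_derivative D) (at y0)"
    by (rule has_derivative_transform_within_open[OF _ U])
  then have "frechet_derivative (\<lambda>y. frechet_derivative (u \<circ> chart_inv c) (at y) v) (at y0) z = D z"
    by (metis frechet_derivative_at)
  also have "D z = g c x (frechet_derivative X (at y0) z) v + g c x (\<Gamma> z (X y0)) v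
      + g c x (X y0) (\<Gamma> z v)"
  proof -
    have "bilinear (\<lambda>w v. g c x (\<Gamma> z w) v)"
      unfolding bilinear_def linear_iff
      by (simp add: bilinear_ladd[OF m(1)] bilinear_radd[OF m(1)] bilinear_lmul[OF m(1)]
          bilinear_rmul[OF m(1)] bilinear_radd[OF \<Gamma>] bilinear_rmul[OF \<Gamma>])
    note e = bilinear_axis_expansion[OF this, of "X y0" v]
      bilinear_axis_expansion[OF m(1), of "frechet_derivative X (at y0) z" v]
      bilinear_axis_expansion[OF m(1), of "X y0" "\<Gamma> z v"]
    show ?thesis unfolding e D_def by (simp add: sum.distrib algebra_simps)
  qed
  also have "g c x (X y0) (\<Gamma> z v) = frechet_derivative (u \<circ> chart_inv c) (at y0) (\<Gamma> z v)"
    using grad_eq[OF M u[unfolded numeral_2_eq_2] c] by (simp add: X_def y0 y0_def[symmetric])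
  finally show ?thesis
    unfolding hess_def cov_deriv_def X_def comp_apply y0
    unfolding bilinear_ladd[OF m(1)] y0_def \<Gamma>_def by (simp add: comp_def)
qed

text \<open>The first derivatives of \<open>u\<close> and \<open>k v\<close> agree at
  \<open>x\<close>, so their Christoffel terms coincide and the second derivatives in the chart
  decide. The trace tests a Hessian only on diagonal pairs \<open>p\<close>, \<open>p\<close>, which
  is where the maximum gives information.\<close>

lemma trace_hess_le_at_max:
  fixes A :: "('m::{t2_space, second_countable_topology}, 'n::finite) chart set"
  assumes M: "riemannian_manifold A g"
    and P: "endomorphism_field A P" "symmetric_field A g P" "pos_semidef_field A g P"
    and u: "Ck_function 2 A u" and v: "Ck_function 2 A v" and k: "k \<ge> 0"
    and max: "\<And>y. u y - k * v y \<le> u x - k * v x"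
  shows "vnorm A g (grad g u) x = k * vnorm A g (grad g v) x"
    and "trace_hess A g P u x \<le> k * trace_hess A g P v x"
proof -
  define c where "c = chart_at A x"
  have c: "c \<in> A" "x \<in> fst c" using chart_at_in[OF M] by (auto simp: c_def)
  note ch = riemannian_manifold_chart[OF M c(1)]
  note m = metric_at[OF M c]
  define U where "U = snd c ` fst c"
  have U: "open U" "snd c x \<in> U" using ch(3) c by (auto simp: U_def)
  have Ck: "Ck_on 2 U (u \<circ> chart_inv c)" "Ck_on 2 U (v \<circ> chart_inv c)"
    using u v c by (simp_all add: Ck_function_def U_def)
  have max': "(u \<circ> chart_inv c) y - k * (v \<circ> chart_inv c) y
      \<le> (u \<circ> chart_inv c) (snd c x) - k * (v \<circ> chart_inv c) (snd c x)" for y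
    using max chart_inv_chart[OF ch(1) c(2)] by simp
  note D = Ck_on_2_max[OF Ck U max']
  note scale = bilinear_lmul[OF m(1)] bilinear_rmul[OF m(1)]
  have hr: "linear (g c x w)" for w using m(1) by (simp add: bilinear_def)
  have "g c x (grad g u c x) w = g c x (k *\<^sub>R grad g v c x) w" for w
    unfolding scale grad_eq[OF M u[unfolded numeral_2_eq_2] c]
      grad_eq[OF M v[unfolded numeral_2_eq_2] c] D(1) by simp
  then have grad: "grad g u c x = k *\<^sub>R grad g v c x"
    using metric_riesz[OF m(1) m(3) hr[of "k *\<^sub>R grad g v c x"]] by blast
  show "vnorm A g (grad g u) x = k * vnorm A g (grad g v) x"
    using k by (simp add: vnorm_def c_def[symmetric] grad scale real_sqrt_mult mult.assoc[symmetric])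
  have hess: "g c x (hess g u c x p) p \<le> k * g c x (hess g v c x p) p" for p
    unfolding metric_hess[OF M u c] metric_hess[OF M v c] D(1) right_diff_distrib
    by (rule diff_right_mono[OF D(2)])
  have lP: "linear (P c x)" using P(1) c by (simp add: endomorphism_field_def)
  have "\<And>v w. g c x (P c x v) w = g c x v (P c x w)" "\<And>v. g c x (P c x v) v \<ge> 0"
    using P(2,3) c by (auto simp: symmetric_field_def pos_semidef_field_def)
  from trace_psd_comp[OF m(1-3) lP this] obtain ps
    where ps: "\<And>H. linear H \<Longrightarrow> trace (matrix (P c x \<circ> H)) = (\<Sum>p\<leftarrow>ps. g c x (H p) p)" by metis
  have "(\<Sum>p\<leftarrow>ps. g c x (hess g u c x p) p) \<le> (\<Sum>p\<leftarrow>ps. k * g c x (hess g v c x p) p)"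
    by (intro sum_list_mono hess)
  then show "trace_hess A g P u x \<le> k * trace_hess A g P v x"
    using ps[OF linear_hess[OF M u c]] ps[OF linear_hess[OF M v c]]
    by (simp add: trace_hess_def c_def[symmetric] sum_list_const_mult)
qed

text \<open>Cauchy-Schwarz for the drift term: at infinity \<open>V\<close> is controlled only
  through its norm.\<close>

lemma semi_elliptic_op_le:
  fixes A :: "('m::{t2_space, second_countable_topology}, 'n::finite) chart set"
  assumes M: "riemannian_manifold A g"
  shows "semi_elliptic_op A g P V u x \<le> trace_hess A g P u x + vnorm A g V x * vnorm A g (grad g u) x"
proof -
  define c where "c = chart_at A x"
  have c: "c \<in> A" "x \<in> fst c" using chart_at_in[OF M] by (auto simp: c_def)
  note m = metric_at[OF M c]
  have "g c x (V c x) (grad g u c x) \<le> sqrt ((g c x (V c x) (grad g u c x))\<^sup>2)" by simp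
  also have "\<dots> \<le> sqrt (g c x (V c x) (V c x) * g c x (grad g u c x) (grad g u c x))"
    by (intro real_sqrt_le_mono psd_cauchy_schwarz m)
  finally show ?thesis
    by (simp add: semi_elliptic_op_def vnorm_def c_def[symmetric] real_sqrt_mult)
qed

lemma vnorm_nonneg:
  assumes "riemannian_manifold A g"
  shows "vnorm A g V x \<ge> 0"
  using metric_at(4)[OF assms chart_at_in[OF assms]] by (simp add: vnorm_def Let_def)


section \<open>The function \<open>\<phi>\<close>\<close>

text \<open>Monotonicity stands for the sign of \<open>G'\<close>: it makes
  \<open>1 / sqrt (G s)\<close> nonincreasing and so the primitive \<open>I\<close> concave, without
  differentiating \<open>I\<close>. Nonintegrability drives \<open>phi G\<close> to
  infinity.\<close>

locale nonintegrable_weight =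
  fixes G :: "real \<Rightarrow> real"
  assumes pos: "\<And>t. t \<ge> 0 \<Longrightarrow> G t > 0"
    and mono: "\<And>s t. 0 \<le> s \<Longrightarrow> s \<le> t \<Longrightarrow> G s \<le> G t"
    and cont: "continuous_on {0..} G"
    and diverges: "(\<integral>\<^sup>+s\<in>{0..}. ennreal (1 / sqrt (G s)) \<partial>lborel) = \<infinity>"
begin

definition I :: "real \<Rightarrow> real" where "I t = integral {0..t} (\<lambda>s. 1 / sqrt (G s))"

lemma continuous_weight: "continuous_on {0..} (\<lambda>s. 1 / sqrt (G s))"
  using pos by (intro continuous_intros cont) force

lemma integrable_weight: "0 \<le> a \<Longrightarrow> (\<lambda>s. 1 / sqrt (G s)) integrable_on {a..b}"
  by (intro integrable_continuous_real continuous_on_subset[OF continuous_weight]) auto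

lemma weight_antimono: "0 \<le> s \<Longrightarrow> s \<le> t \<Longrightarrow> 1 / sqrt (G t) \<le> 1 / sqrt (G s)"
  using pos mono by (intro divide_left_mono) (auto simp: order_less_imp_le)

lemma I_nonneg: "I t \<ge> 0"
  unfolding I_def using pos
  by (intro integral_nonneg integrable_weight) (auto simp: order_less_imp_le)

lemma I_diff: "0 \<le> s \<Longrightarrow> s \<le> t \<Longrightarrow> I t - I s = integral {s..t} (\<lambda>s. 1 / sqrt (G s))"
  unfolding I_def using Henstock_Kurzweil_Integration.integral_combine[of 0 s t "\<lambda>s. 1 / sqrt (G s)"]
    integrable_weight[of 0 t] by simp

text \<open>A nonincreasing integrand lies below its value at \<open>s\<close> to the right of
  \<open>s\<close> and above it to the left, which gives the tangent-line inequality on both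
  sides.\<close>

lemma I_concave:
  assumes "0 \<le> s" "0 \<le> t"
  shows "I t - I s \<le> (t - s) / sqrt (G s)"
proof (cases "s \<le> t")
  case True
  have "integral {s..t} (\<lambda>s. 1 / sqrt (G s)) \<le> integral {s..t} (\<lambda>_. 1 / sqrt (G s))"
    using assms by (intro integral_le integrable_weight weight_antimono) auto
  then show ?thesis using True assms by (simp add: I_diff)
next
  case False
  have "integral {t..s} (\<lambda>_. 1 / sqrt (G s)) \<le> integral {t..s} (\<lambda>s. 1 / sqrt (G s))"
    using assms by (intro integral_le integrable_weight weight_antimono) auto
  then show ?thesis using False assms I_diff[of t s] by (simp add: diff_divide_distrib)
qed

lemma I_mono: "0 \<le> s \<Longrightarrow> s \<le> t \<Longrightarrow> I s \<le> I t"
  using I_concave[of t s] pos[of t] by (smt (verit) divide_nonpos_nonneg real_sqrt_ge_zero)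

lemma phi_eq: "phi G t = ln (I t + 1)"
  by (simp add: phi_def I_def)

lemma phi_nonneg: "phi G t \<ge> 0"
  using I_nonneg[of t] by (simp add: phi_eq)

text \<open>The tangent-line inequalities of \<open>ln\<close> at \<open>I s + 1\<close> and of
  \<open>I\<close> at \<open>s\<close> are chained; the denominator is the reciprocal of the
  derivative of \<open>phi G\<close> at \<open>s\<close>.\<close>

lemma phi_concave:
  assumes "0 \<le> s" "0 \<le> t"
  shows "phi G t - phi G s \<le> (t - s) / (sqrt (G s) * (I s + 1))"
proof -
  have p: "I s + 1 > 0" "I t + 1 > 0" using I_nonneg[of s] I_nonneg[of t] by auto
  have "phi G t - phi G s \<le> (I t + 1 - (I s + 1)) / (I s + 1)"
    unfolding phi_eq using p by (intro ln_diff_le)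
  also have "\<dots> \<le> ((t - s) / sqrt (G s)) / (I s + 1)"
    using I_concave[OF assms] p by (intro divide_right_mono) auto
  finally show ?thesis by simp
qed

lemma continuous_phi: "continuous_on {0..} (phi G)"
proof -
  \<comment> \<open>The weight is largest at \<open>0\<close>, and its value there is a Lipschitz
    constant for \<open>I\<close>.\<close>
  have "I t - I s \<le> 1 / sqrt (G 0) * \<bar>t - s\<bar>" if "0 \<le> s" "0 \<le> t" for s t
  proof -
    have "I t - I s \<le> (1 / sqrt (G s)) * (t - s)" using I_concave[OF that] by simp
    also have "\<dots> \<le> (1 / sqrt (G s)) * \<bar>t - s\<bar>"
      using pos[of s] that by (intro mult_left_mono) auto
    also have "\<dots> \<le> (1 / sqrt (G 0)) * \<bar>t - s\<bar>"
      using that by (intro mult_right_mono weight_antimono) auto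
    finally show ?thesis .
  qed
  then have "dist (I x) (I y) \<le> 1 / sqrt (G 0) * dist x y" if "0 \<le> x" "0 \<le> y" for x y
    using that unfolding dist_real_def by (metis abs_le_iff abs_minus_commute minus_diff_eq)
  then have "(1 / sqrt (G 0))-lipschitz_on {0..} I"
    using pos[of 0] by (intro lipschitz_onI) auto
  then have "continuous_on {0..} I" by (rule lipschitz_on_continuous_on)
  then show ?thesis
    unfolding phi_eq[abs_def] using I_nonneg
    by (intro continuous_intros) (auto simp: add_nonneg_eq_0_iff)
qed

text \<open>A bound for \<open>I\<close> along the naturals would, by monotone convergence, bound
  the divergent integral.\<close>

lemma I_at_top: "filterlim I at_top at_top"
proof -
  have "\<exists>t\<ge>0. I t > C" for C
  proof (rule ccontr)
    assume "\<not> (\<exists>t\<ge>0. I t > C)"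
    then have C: "I (real n) \<le> C" for n by (auto simp: not_less)
    \<comment> \<open>\<open>G\<close> is arbitrary on the negative axis, so measurability is
      derived from continuity on \<open>{0..real n}\<close> together with the indicator.\<close>
    have meas: "(\<lambda>s. ennreal (1 / sqrt (G s)) * indicator {0..real n} s) \<in> borel_measurable lborel" for n
    proof -
      have "(\<lambda>s. indicator {0..real n} s *\<^sub>R (1 / sqrt (G s))) \<in> borel_measurable borel"
        by (intro borel_measurable_continuous_on_indicator continuous_on_subset[OF continuous_weight]) auto
      then have "(\<lambda>s. ennreal (indicator {0..real n} s *\<^sub>R (1 / sqrt (G s)))) \<in> borel_measurable lborel"
        by simp
      then show ?thesis
        by (rule back_subst[of "\<lambda>f. f \<in> borel_measurable lborel"]) (auto simp: indicator_def)
    qed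
    have "(\<integral>\<^sup>+s\<in>{0..}. ennreal (1 / sqrt (G s)) \<partial>lborel)
        = (\<integral>\<^sup>+s. (SUP n. ennreal (1 / sqrt (G s)) * indicator {0..real n} s) \<partial>lborel)"
    proof (rule nn_integral_cong)
      fix s :: real
      obtain N :: nat where N: "s \<le> real N" using real_arch_simple by blast
      show "ennreal (1 / sqrt (G s)) * indicator {0..} s
          = (SUP n. ennreal (1 / sqrt (G s)) * indicator {0..real n} s)"
        by (intro antisym SUP_upper2[of N] SUP_least) (use N in \<open>auto simp: indicator_def\<close>)
    qed
    also have "\<dots> = (SUP n. \<integral>\<^sup>+s. ennreal (1 / sqrt (G s)) * indicator {0..real n} s \<partial>lborel)"
      by (rule nn_integral_monotone_convergence_SUP[OF _ meas])
        (auto simp: incseq_def le_fun_def indicator_def)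
    also have "\<dots> = (SUP n. ennreal (I (real n)))"
      unfolding I_def using pos
      by (intro SUP_cong refl nn_integral_has_integral_lebesgue' integrable_integral integrable_weight)
        (auto simp: order_less_imp_le)
    also have "\<dots> \<le> ennreal C" using C by (intro SUP_least ennreal_leI)
    finally show False using diverges by (simp add: top_unique)
  qed
  then show ?thesis
    unfolding filterlim_at_top_gt[of _ _ 0] eventually_at_top_linorder
    by (meson I_mono less_imp_le order_trans)
qed

lemma phi_at_top: "filterlim (phi G) at_top at_top"
  unfolding phi_eq[abs_def]
  by (intro filterlim_compose[OF ln_at_top] filterlim_at_top_mono[OF I_at_top]) simp

end


section \<open>Maximising sequences\<close>

text \<open>Growth at rate \<open>e / 2\<close> leaves at most \<open>- (e / 2) * \<psi>\<close> for
  the difference, which drops below any given level off a compact set.\<close>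

lemma exists_max_minus_exhaustion:
  fixes u \<psi> :: "'m::topological_space \<Rightarrow> real"
  assumes u: "continuous_on UNIV u" and \<psi>: "continuous_on UNIV \<psi>"
    and lim: "filterlim \<psi> at_top leaving_compacts"
    and growth: "\<And>e. e > 0 \<Longrightarrow> eventually (\<lambda>x. u x \<le> e * \<psi> x) leaving_compacts"
    and e: "e > 0"
  obtains x where "\<And>y. u y - e * \<psi> y \<le> u x - e * \<psi> x"
proof -
  define p :: 'm where "p = undefined"
  define m where "m = u p - e * \<psi> p"
  \<comment> \<open>The threshold at which \<open>- (e / 2) * \<psi> x\<close> falls below
    \<open>m\<close>.\<close>
  have "eventually (\<lambda>x. \<psi> x > - 2 * m / e) leaving_compacts"
    using lim by (simp add: filterlim_at_top_dense)
  moreover have "eventually (\<lambda>x. u x \<le> e / 2 * \<psi> x) leaving_compacts"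
    by (rule growth) (use e in simp)
  ultimately have "eventually (\<lambda>x. u x - e * \<psi> x < m) leaving_compacts"
    by eventually_elim (use e in \<open>simp add: field_simps\<close>)
  then obtain K where K: "compact K" "\<And>x. x \<notin> K \<Longrightarrow> u x - e * \<psi> x < m"
    unfolding eventually_leaving_compacts by blast
  \<comment> \<open>The strict inequality fails at \<open>p\<close> itself. So \<open>K\<close> is
    nonempty, and the maximum over \<open>K\<close> is at least \<open>m\<close>, hence
    global.\<close>
  then have p: "p \<in> K" unfolding m_def by blast
  have "continuous_on K (\<lambda>x. u x - e * \<psi> x)"
    by (intro continuous_intros continuous_on_subset[OF u] continuous_on_subset[OF \<psi>]) auto
  from continuous_attains_sup[OF K(1) _ this] p obtain x
    where x: "x \<in> K" "\<And>y. y \<in> K \<Longrightarrow> u y - e * \<psi> y \<le> u x - e * \<psi> x" by blast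
  have "u y - e * \<psi> y \<le> u x - e * \<psi> x" for y
    using x(2)[of y] x(2)[OF p] K(2)[of y] unfolding m_def by fastforce
  then show thesis by (rule that)
qed

text \<open>Here \<open>\<psi>\<close> stands for \<open>\<phi> \<circ> \<gamma>\<close> and \<open>w\<close> for \<open>1 / \<phi>' \<circ> \<gamma>\<close>. As \<open>P\<close> and \<open>V\<close> may be
  unbounded on compact sets, it is essential that the maximum points of \<open>u - \<epsilon> \<psi>\<close> leave \<open>K\<close>
  once \<open>u\<close> has no maximum.\<close>

lemma maximising_sequence:
  fixes A :: "('m::{t2_space, second_countable_topology}, 'n::finite) chart set"
  assumes M: "riemannian_manifold A g"
    and P: "endomorphism_field A P" "symmetric_field A g P" "pos_semidef_field A g P"
    and \<gamma>: "Ck_function 2 A \<gamma>" and u: "Ck_function 2 A u"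
    and \<psi>: "continuous_on UNIV \<psi>" "\<And>x. \<psi> x \<ge> 0" "filterlim \<psi> at_top leaving_compacts"
    and w: "\<And>x. w x > 0" and concave: "\<And>x y. \<psi> y - \<psi> x \<le> (\<gamma> y - \<gamma> x) / w x"
    and abC: "a \<ge> 0" "b \<ge> 0" "C \<ge> 0" and K: "compact K"
    and a: "\<And>x. x \<notin> K \<Longrightarrow> vnorm A g (grad g \<gamma>) x \<le> a * w x"
    and b: "\<And>x. x \<notin> K \<Longrightarrow> trace_hess A g P \<gamma> x \<le> b * w x"
    and C: "\<And>x. x \<notin> K \<Longrightarrow> vnorm A g V x \<le> C"
    and growth: "\<And>e. e > 0 \<Longrightarrow> eventually (\<lambda>x. u x \<le> e * \<psi> x) leaving_compacts"
  shows "\<exists>x :: nat \<Rightarrow> 'm. (\<forall>k\<ge>1. vnorm A g (grad g u) (x k) < 1 / real k \<and>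
      semi_elliptic_op A g P V u (x k) < 1 / real k) \<and>
      (bdd_above (range u) \<longrightarrow> (\<lambda>k. u (x k)) \<longlonglongrightarrow> (SUP y. u y))"
proof (cases "\<exists>x. \<forall>y. u y \<le> u x")
  case True
  then obtain x where x: "\<And>y. u y \<le> u x" by blast
  \<comment> \<open>Comparison with factor 0 is the ordinary maximum principle; \<open>u\<close>
    itself fills the place of the comparison function.\<close>
  have "vnorm A g (grad g u) x = 0" "trace_hess A g P u x \<le> 0"
    using trace_hess_le_at_max[OF M P u u, of 0 x] x by simp_all
  moreover from this have "semi_elliptic_op A g P V u x \<le> 0"
    using semi_elliptic_op_le[OF M, of P V u x] by simp
  moreover have "(SUP y. u y) = u x"
    using x by (intro cSup_eq_maximum) auto
  ultimately show ?thesis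
    by (intro exI[of _ "\<lambda>_. x"]) (auto intro: le_less_trans)
next
  case False
  have ucont: "continuous_on UNIV u"
    using Ck_function_continuous[OF M] u by (simp add: numeral_2_eq_2)
  have "\<exists>x. \<forall>y. u y - e * \<psi> y \<le> u x - e * \<psi> x" if "e > 0" for e
    using exists_max_minus_exhaustion[OF ucont \<psi>(1,3) growth that] by metis
  then obtain \<xi> where \<xi>: "\<And>e y. e > 0 \<Longrightarrow> u y - e * \<psi> y \<le> u (\<xi> e) - e * \<psi> (\<xi> e)" by metis
  \<comment> \<open>The nonnegative term at \<open>\<xi> e\<close> is dropped. This bound yields
    both the escape from \<open>K\<close> and the convergence to the supremum.\<close>
  have low: "u z - e * \<psi> z \<le> u (\<xi> e)" if "e > 0" for e z
    using \<xi>[OF that, of z] mult_nonneg_nonneg[of e, OF _ \<psi>(2)[of "\<xi> e"]] that by linarith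
  obtain d where d: "d > 0" "\<And>e. 0 < e \<Longrightarrow> e < d \<Longrightarrow> \<xi> e \<notin> K"
  proof (cases "K = {}")
    case True
    then show thesis using that[of 1] by simp
  next
    case ne: False
    obtain z where z: "\<And>y. y \<in> K \<Longrightarrow> u y \<le> u z"
      using continuous_attains_sup[OF K ne continuous_on_subset[OF ucont]] by blast
    \<comment> \<open>As \<open>u\<close> has no maximum, some \<open>y\<close> beats all of
      \<open>K\<close>; for small \<open>e\<close>, \<open>low\<close> at \<open>y\<close> puts
      \<open>u (\<xi> e)\<close> above \<open>u z\<close>. The 1 in the threshold below is there
      because \<open>\<psi> y\<close> may vanish.\<close>
    obtain y where y: "u y > u z" using False by (meson not_le)
    have p: "\<psi> y + 1 > 0" using \<psi>(2)[of y] by simp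
    show thesis
    proof (rule that)
      show "(u y - u z) / (\<psi> y + 1) > 0" using p y by simp
      fix e :: real assume e: "0 < e" "e < (u y - u z) / (\<psi> y + 1)"
      then have "e * \<psi> y < u y - u z" using p by (simp add: field_simps)
      then show "\<xi> e \<notin> K" using low[OF e(1), of y] z[of "\<xi> e"] by fastforce
    qed
  qed
  \<comment> \<open>Dominates the gradient constant \<open>a\<close> and the operator constant
    \<open>b + C * a\<close>; the summand 1 gives \<open>s \<ge> 1\<close>, so division by
    \<open>s\<close> is safe.\<close>
  define s where "s = 1 + a + b + C * a"
  have s: "s \<ge> 1" "a \<le> s" "b + C * a \<le> s" using abC by (auto simp: s_def)
  \<comment> \<open>The first bound keeps the points off \<open>K\<close>, the second makes the
    estimates strictly smaller than \<open>1 / real k\<close>; \<open>real k + 1\<close> avoids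
    division by zero at index 0.\<close>
  define e where "e k = min (d / 2) (1 / (2 * (real k + 1) * s))" for k
  have e: "e k > 0" "e k < d" for k using d(1) s by (auto simp: e_def)
  have es: "e k * s \<le> 1 / (2 * (real k + 1))" for k
  proof -
    have "e k \<le> 1 / (2 * (real k + 1) * s)" by (simp add: e_def)
    then have "e k * s \<le> 1 / (2 * (real k + 1) * s) * s" using s by (intro mult_right_mono) auto
    then show ?thesis using s by simp
  qed
  have ek: "e k * t < 1 / real k" if "k \<ge> 1" "t \<le> s" for k t
  proof -
    have "e k * t \<le> e k * s" using e that by (intro mult_left_mono) (auto simp: less_imp_le)
    also have "\<dots> \<le> 1 / (2 * (real k + 1))" by (rule es)
    also have "\<dots> < 1 / real k" using that by (simp add: field_simps)
    finally show ?thesis .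
  qed
  have e0: "e \<longlonglongrightarrow> 0"
  proof (rule tendsto_sandwich)
    have "e k \<le> 1 / real (Suc k)" for k
    proof -
      have "e k \<le> e k * s" using e[of k] s by simp
      also have "\<dots> \<le> 1 / (2 * (real k + 1))" by (rule es)
      also have "\<dots> \<le> 1 / real (Suc k)" by (simp add: field_simps)
      finally show ?thesis .
    qed
    then show "\<forall>\<^sub>F k in sequentially. e k \<le> 1 / real (Suc k)" by simp
    show "\<forall>\<^sub>F k in sequentially. 0 \<le> e k" using e by (simp add: less_imp_le)
    show "(\<lambda>k. 1 / real (Suc k)) \<longlonglongrightarrow> 0" by (rule lim_1_over_n[THEN LIMSEQ_Suc])
  qed simp
  define x where "x k = \<xi> (e k)" for k
  have "vnorm A g (grad g u) (x k) \<le> e k * a \<and>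
      semi_elliptic_op A g P V u (x k) \<le> e k * (b + C * a)" for k
  proof -
    have xK: "x k \<notin> K" using d(2) e by (simp add: x_def)
    define l where "l = e k / w (x k)"
    have l: "l \<ge> 0" using e w by (simp add: l_def less_imp_le)
    have lw: "l * (t * w (x k)) = e k * t" for t using w[of "x k"] by (simp add: l_def)
    \<comment> \<open>By \<open>concave\<close>, \<open>l * \<gamma>\<close> plus a constant lies
      above \<open>e k * \<psi>\<close> and touches it at \<open>x k\<close>; subtracting it instead
      keeps the maximum there.\<close>
    have "u y - l * \<gamma> y \<le> u (x k) - l * \<gamma> (x k)" for y
    proof -
      have "e k * (\<psi> y - \<psi> (x k)) \<le> e k * ((\<gamma> y - \<gamma> (x k)) / w (x k))"
        using concave e by (intro mult_left_mono) (auto simp: less_imp_le)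
      also have "\<dots> = l * \<gamma> y - l * \<gamma> (x k)" by (simp add: l_def algebra_simps diff_divide_distrib)
      finally show ?thesis using \<xi>[OF e(1), of y k] by (simp add: x_def algebra_simps)
    qed
    note max = trace_hess_le_at_max[OF M P u \<gamma> l this]
    have grad: "vnorm A g (grad g u) (x k) \<le> e k * a"
      unfolding max(1) lw[symmetric] using a[OF xK] l by (rule mult_left_mono)
    have "semi_elliptic_op A g P V u (x k)
        \<le> l * trace_hess A g P \<gamma> (x k) + vnorm A g V (x k) * vnorm A g (grad g u) (x k)"
      using semi_elliptic_op_le[OF M, of P V u "x k"] max(2) by linarith
    also have "\<dots> \<le> l * (b * w (x k)) + C * (e k * a)"
      using b[OF xK] C[OF xK] l grad abC vnorm_nonneg[OF M]
      by (intro add_mono mult_left_mono mult_mono) auto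
    also have "\<dots> = e k * (b + C * a)" unfolding lw by (simp add: algebra_simps)
    finally show ?thesis using grad by blast
  qed
  then have "\<forall>k\<ge>1. vnorm A g (grad g u) (x k) < 1 / real k \<and>
      semi_elliptic_op A g P V u (x k) < 1 / real k"
    using ek s(2,3) by (meson le_less_trans)
  \<comment> \<open>For each fixed \<open>z\<close>, \<open>u (x k)\<close> is at least
    \<open>u z - e k * \<psi> z\<close>, which tends to \<open>u z\<close>.\<close>
  moreover have "(\<lambda>k. u (x k)) \<longlonglongrightarrow> (SUP y. u y)" if bdd: "bdd_above (range u)"
  proof (rule increasing_tendsto)
    show "\<forall>\<^sub>F k in sequentially. u (x k) \<le> (SUP y. u y)"
      using cSUP_upper[OF _ bdd] by simp
    fix l assume "l < (SUP y. u y)"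
    then obtain z where z: "l < u z" using less_cSUP_iff[OF _ bdd] by auto
    have "(\<lambda>k. u z - e k * \<psi> z) \<longlonglongrightarrow> u z - 0 * \<psi> z" by (intro tendsto_intros e0)
    then have "\<forall>\<^sub>F k in sequentially. l < u z - e k * \<psi> z"
      using z by (intro order_tendstoD) auto
    then show "\<forall>\<^sub>F k in sequentially. l < u (x k)"
      by eventually_elim (unfold x_def, rule less_le_trans[OF _ low[OF e(1)]])
  qed
  ultimately show ?thesis by (intro exI[of _ x] conjI impI)
qed

section \<open>Reduction of both alternatives to a one-sided growth bound on
  \<open>u\<close>\<close>

theorem theorem1:
  fixes A :: "('m::{t2_space, second_countable_topology}, 'n::finite) chart set"
    and g :: "('m, 'n) metric"
    and P :: "('m, 'n) chart \<Rightarrow> 'm \<Rightarrow> real ^ 'n \<Rightarrow> real ^ 'n"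
    and V :: "('m, 'n) chart \<Rightarrow> 'm \<Rightarrow> real ^ 'n"
    and G G' :: "real \<Rightarrow> real"
    and \<gamma> :: "'m \<Rightarrow> real"
  assumes "riemannian_manifold A g" and "complete_riemannian A g"
    and "endomorphism_field A P" and "symmetric_field A g P" and "pos_semidef_field A g P"
    and "vector_field A V"
    and "Limsup leaving_compacts (\<lambda>x. ereal (vnorm A g V x)) < \<infinity>"
    and "\<And>t. t \<ge> 0 \<Longrightarrow> G t \<ge> 0"
    and "G 0 > 0"
    and "\<And>t. t \<ge> 0 \<Longrightarrow> (G has_real_derivative G' t) (at t within {0..})"
    and "\<And>t. t \<ge> 0 \<Longrightarrow> G' t \<ge> 0"
    and "(\<integral>\<^sup>+s\<in>{0..}. ennreal (1 / sqrt (G s)) \<partial>lborel) = \<infinity>"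
    and "Ck_function 2 A \<gamma>" and "\<And>x. \<gamma> x \<ge> 0"
    and "filterlim \<gamma> at_top leaving_compacts"
    and "\<exists>a>0. \<exists>K. compact K \<and> (\<forall>x. x \<notin> K \<longrightarrow>
           vnorm A g (grad g \<gamma>) x
             \<le> a * sqrt (G (\<gamma> x)) * (integral {0..\<gamma> x} (\<lambda>s. 1 / sqrt (G s)) + 1))"
    and "\<exists>b>0. \<exists>K. compact K \<and> (\<forall>x. x \<notin> K \<longrightarrow>
           trace_hess A g P \<gamma> x
             \<le> b * sqrt (G (\<gamma> x)) * (integral {0..\<gamma> x} (\<lambda>s. 1 / sqrt (G s)) + 1))"
  shows "(\<forall>u. Ck_function 2 A u \<longrightarrow> ((\<lambda>x. u x / phi G (\<gamma> x)) \<longlongrightarrow> 0) leaving_compacts \<longrightarrow>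
            (\<exists>x :: nat \<Rightarrow> 'm. \<forall>k\<ge>1.
               vnorm A g (grad g u) (x k) < 1 / real k \<and>
               semi_elliptic_op A g P V u (x k) < 1 / real k))
       \<and> (\<forall>u. Ck_function 2 A u \<longrightarrow> bdd_above (range u) \<longrightarrow>
            (\<exists>x :: nat \<Rightarrow> 'm. (\<forall>k\<ge>1.
               vnorm A g (grad g u) (x k) < 1 / real k \<and>
               semi_elliptic_op A g P V u (x k) < 1 / real k) \<and>
               (\<lambda>k. u (x k)) \<longlonglongrightarrow> (SUP y. u y)))"
proof -
  note M = assms(1) and P = assms(3-5) and G_deriv = assms(10) and \<gamma> = assms(13)
  note \<gamma>_nonneg = assms(14) and \<gamma>_lim = assms(15)
  have G_cont: "continuous_on {0..} G"
    using G_deriv by (auto simp: continuous_on_eq_continuous_within intro: DERIV_continuous)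
  have G_mono: "G s \<le> G t" if "0 \<le> s" "s \<le> t" for s t
  proof (rule DERIV_nonneg_imp_increasing_open[OF that(2)])
    fix r assume "s < r" "r < t"
    \<comment> \<open>At interior points the derivative within the half-line is an ordinary one;
      \<open>-1\<close> is just a point outside the half-line.\<close>
    then have "r \<in> interior {0..}" using that by (simp add: interior_Ici[of "-1"])
    then have "(G has_real_derivative G' r) (at r)"
      using G_deriv[of r] at_within_interior[of r "{0..}"] that \<open>s < r\<close> by simp
    then show "\<exists>y. (G has_real_derivative y) (at r) \<and> 0 \<le> y"
      using assms(11)[of r] that \<open>s < r\<close> by auto
  qed (use continuous_on_subset[OF G_cont] that in auto)
  interpret W: nonintegrable_weight G
  proof
    show "G t > 0" if "t \<ge> 0" for t using G_mono[of 0 t] assms(9) that by simp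
  qed (use G_mono G_cont assms(12) in auto)
  define \<psi> where "\<psi> x = phi G (\<gamma> x)" for x
  \<comment> \<open>The common factor in the bounds on the gradient and the trace for
    \<open>\<gamma>\<close>; it is the reciprocal of the derivative of \<open>phi G\<close> at
    \<open>\<gamma> x\<close>.\<close>
  define w where "w x = sqrt (G (\<gamma> x)) * (W.I (\<gamma> x) + 1)" for x
  have w: "w x > 0" for x
    using W.pos[OF \<gamma>_nonneg] W.I_nonneg[of "\<gamma> x"] by (simp add: w_def add_nonneg_pos)
  obtain a Ka where a: "a > 0" "compact Ka" "\<And>x. x \<notin> Ka \<Longrightarrow> vnorm A g (grad g \<gamma>) x \<le> a * w x"
    using assms(16) by (auto simp: w_def W.I_def mult.assoc)
  obtain b Kb where b: "b > 0" "compact Kb" "\<And>x. x \<notin> Kb \<Longrightarrow> trace_hess A g P \<gamma> x \<le> b * w x"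
    using assms(17) by (auto simp: w_def W.I_def mult.assoc)
  obtain C0 where C0: "Limsup leaving_compacts (\<lambda>x. ereal (vnorm A g V x)) < ereal C0"
    using ereal_dense2[OF assms(7)] by blast
  then obtain KV where KV: "compact KV" "\<And>x. x \<notin> KV \<Longrightarrow> vnorm A g V x < C0"
    using Limsup_lessD[OF C0] unfolding eventually_leaving_compacts by auto
  define K where "K = Ka \<union> Kb \<union> KV"
  have K: "compact K" using a b KV by (auto simp: K_def intro: compact_Un)
  have \<psi>_lim: "filterlim \<psi> at_top leaving_compacts"
    unfolding \<psi>_def[abs_def] by (rule filterlim_compose[OF W.phi_at_top \<gamma>_lim])
  \<comment> \<open>The growth bound is what the two alternatives share: it follows from the
    vanishing limit as well as from an upper bound on \<open>u\<close>.\<close>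
  have main: "\<exists>x :: nat \<Rightarrow> 'm. (\<forall>k\<ge>1. vnorm A g (grad g u) (x k) < 1 / real k \<and>
      semi_elliptic_op A g P V u (x k) < 1 / real k) \<and>
      (bdd_above (range u) \<longrightarrow> (\<lambda>k. u (x k)) \<longlonglongrightarrow> (SUP y. u y))"
    if u: "Ck_function 2 A u"
      and growth: "\<forall>e>0. eventually (\<lambda>x. u x \<le> e * \<psi> x) leaving_compacts" for u
  proof (rule maximising_sequence[OF M P \<gamma> u _ _ \<psi>_lim w _ _ _ _ K _ _ _ growth[rule_format]])
    show "continuous_on UNIV \<psi>"
      unfolding \<psi>_def[abs_def] using \<gamma>_nonneg Ck_function_continuous[OF M] \<gamma>
      by (intro continuous_on_compose2[OF W.continuous_phi]) (auto simp: numeral_2_eq_2)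
    show "\<psi> x \<ge> 0" for x by (simp add: \<psi>_def W.phi_nonneg)
    show "\<psi> y - \<psi> x \<le> (\<gamma> y - \<gamma> x) / w x" for x y
      unfolding \<psi>_def w_def by (intro W.phi_concave \<gamma>_nonneg)
    \<comment> \<open>If the manifold is compact, the limsup is minus infinity and \<open>C0\<close>
      may be negative, hence the maximum with 0.\<close>
    show "a \<ge> 0" "b \<ge> 0" "max 0 C0 \<ge> 0" using a b by auto
    show "vnorm A g V x \<le> max 0 C0" if "x \<notin> K" for x using KV(2)[of x] that by (auto simp: K_def)
  qed (use a(3) b(3) in \<open>auto simp: K_def\<close>)
  show ?thesis
  proof (intro conjI allI impI)
    fix u assume u: "Ck_function 2 A u" and lim: "((\<lambda>x. u x / phi G (\<gamma> x)) \<longlongrightarrow> 0) leaving_compacts"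
    have "eventually (\<lambda>x. u x \<le> e * \<psi> x) leaving_compacts" if "e > 0" for e
    proof -
      have "eventually (\<lambda>x. u x / \<psi> x < e) leaving_compacts"
        using order_tendstoD(2)[OF lim that] by (simp add: \<psi>_def)
      \<comment> \<open>Positivity lets the denominator be cleared; \<open>phi G\<close> vanishes at
        \<open>0\<close>, so it holds only eventually.\<close>
      moreover have "eventually (\<lambda>x. \<psi> x > 0) leaving_compacts"
        using \<psi>_lim by (simp add: filterlim_at_top_dense)
      ultimately show ?thesis by eventually_elim (simp add: field_simps)
    qed
    then have "\<forall>e>0. eventually (\<lambda>x. u x \<le> e * \<psi> x) leaving_compacts" by blast
    from main[OF u this] show "\<exists>x :: nat \<Rightarrow> 'm. \<forall>k\<ge>1. vnorm A g (grad g u) (x k) < 1 / real k \<and>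
      semi_elliptic_op A g P V u (x k) < 1 / real k"
      by (elim exE conjE) (rule exI)
  next
    fix u assume u: "Ck_function 2 A u" and bdd: "bdd_above (range u)"
    then obtain B where B: "\<And>x. u x \<le> B" by (auto simp: bdd_above_def)
    have "eventually (\<lambda>x. u x \<le> e * \<psi> x) leaving_compacts" if "e > 0" for e
    proof -
      have "eventually (\<lambda>x. \<psi> x \<ge> B / e) leaving_compacts"
        using \<psi>_lim by (simp add: filterlim_at_top)
      then show ?thesis
      proof eventually_elim
        fix x assume "B / e \<le> \<psi> x"
        then have "B \<le> e * \<psi> x" using that by (simp add: field_simps)
        then show "u x \<le> e * \<psi> x" using B[of x] by simp
      qed
    qed
    then have "\<forall>e>0. eventually (\<lambda>x. u x \<le> e * \<psi> x) leaving_compacts" by blast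
    from main[OF u this] show "\<exists>x :: nat \<Rightarrow> 'm. (\<forall>k\<ge>1. vnorm A g (grad g u) (x k) < 1 / real k \<and>
      semi_elliptic_op A g P V u (x k) < 1 / real k) \<and> (\<lambda>k. u (x k)) \<longlonglongrightarrow> (SUP y. u y)"
      by (elim exE conjE) (intro exI conjI, assumption, erule mp, rule bdd)
  qed
qed

end
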